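(* There exists a constant $c>0$ such that for all sufficiently large $n\in\mathbb{N}$ there exists an $n$-vertex graph $G$ with $\chi_f(G)\ge c\,\frac{\log\log n}{\log\log\log n}$ such that $G$ contains no $4$-regular subgraph.
   Context: $\chi_f(G)$ denotes the fractional chromatic number of $G$: the minimum of $\sum_{I} x_I$ over nonnegative weights $x_I$ on the independent sets $I$ of $G$ subject to $\sum_{I\ni v} x_I\ge 1$ for every vertex $v$. A $4$-regular subgraph is a (not necessarily induced, nonempty) subgraph in which every vertex has degree exactly $4$. *)

theory Defs
  imports
    "HOL-Analysis.Analysis"
    "Graph_Theory.Graph_Theory"
begin

text \<open>
  A finite simple undirected graph is a \<^const>\<open>pair_graph\<close>: a finite vertex set together with an
  irreflexive symmetric set of arcs, each undirected edge \<open>uv\<close> being represented by the two arcs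
  \<open>(u, v)\<close> and \<open>(v, u)\<close>. Hence the degree of a vertex is its \<^const>\<open>out_degree\<close>.
\<close>

definition independent_sets :: "'a pair_pre_digraph \<Rightarrow> 'a set set" where
  "independent_sets G = {I. I \<subseteq> pverts G \<and> (\<forall>u\<in>I. \<forall>v\<in>I. (u, v) \<notin> parcs G)}"

definition fractional_colorings :: "'a pair_pre_digraph \<Rightarrow> ('a set \<Rightarrow> real) set" where
  "fractional_colorings G = {x.
     (\<forall>I\<in>independent_sets G. 0 \<le> x I) \<and>
     (\<forall>v\<in>pverts G. 1 \<le> (\<Sum>I | I \<in> independent_sets G \<and> v \<in> I. x I))}"

definition fractional_chromatic_number :: "'a pair_pre_digraph \<Rightarrow> real" where
  "fractional_chromatic_number G =
     (INF x\<in>fractional_colorings G. \<Sum>I\<in>independent_sets G. x I)"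

definition regular_graph :: "nat \<Rightarrow> 'a pair_pre_digraph \<Rightarrow> bool" where
  "regular_graph k H \<longleftrightarrow> pair_graph H \<and> (\<forall>v\<in>pverts H. out_degree (with_proj H) v = k)"

definition has_regular_subgraph :: "nat \<Rightarrow> 'a pair_pre_digraph \<Rightarrow> bool" where
  "has_regular_subgraph k G \<longleftrightarrow>
     (\<exists>H :: 'a pair_pre_digraph. subgraph (with_proj H) (with_proj G) \<and> pverts H \<noteq> {} \<and> regular_graph k H)"

lemma finite_independent_sets:
  assumes "pair_graph G"
  shows "finite (independent_sets G)"
proof -
  interpret pair_graph G by fact
  have "independent_sets G \<subseteq> Pow (pverts G)"
    by (auto simp: independent_sets_def)
  then show ?thesis
    using pair_finite_verts finite_subset by blast
qed

text \<open>The infimum defining the fractional chromatic number is a minimum.\<close>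

lemma fractional_chromatic_number_attained:
  fixes G :: "'a pair_pre_digraph"
  assumes "pair_graph G"
  obtains x where "x \<in> fractional_colorings G"
    and "fractional_chromatic_number G = (\<Sum>I\<in>independent_sets G. x I)"
    and "\<And>y. y \<in> fractional_colorings G \<Longrightarrow>
           (\<Sum>I\<in>independent_sets G. x I) \<le> (\<Sum>I\<in>independent_sets G. y I)"
proof -
  interpret pair_graph G by fact
  let ?\<I> = "independent_sets G"
  let ?w = "\<lambda>x :: 'a set \<Rightarrow> real. \<Sum>I\<in>?\<I>. x I"
  note fin = finite_independent_sets[OF assms]
  define B :: "'a set \<Rightarrow> real set" where "B = (\<lambda>_. {0..1})"
  define K where "K = fractional_colorings G \<inter> PiE UNIV B"
  have box: "compact (PiE UNIV B)"
    unfolding B_def using compactin_PiE[of "\<lambda>_. euclidean" UNIV "\<lambda>_::'a set. {0..1::real}"]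
    by (simp add: euclidean_product_topology)
  have coord: "continuous_on UNIV (\<lambda>x :: 'a set \<Rightarrow> real. x I)" for I
    by (rule continuous_on_product_coordinates)
  have closed: "closed (fractional_colorings G)"
    unfolding fractional_colorings_def Ball_def
    by (intro closed_Collect_conj closed_Collect_all closed_Collect_imp open_Collect_const closed_Collect_le continuous_on_const
        continuous_on_sum coord)
  have compact: "compact K"
    unfolding K_def using closed box by (simp add: closed_Int_compact)
  have clip: "\<exists>z\<in>K. ?w z \<le> ?w y" if y: "y \<in> fractional_colorings G" for y
  proof
    define z where "z = (\<lambda>I. if I \<in> ?\<I> then min (y I) 1 else 0)"
    have y0: "0 \<le> y I" if "I \<in> ?\<I>" for I
      using y that by (simp add: fractional_colorings_def)
    have "1 \<le> (\<Sum>I | I \<in> ?\<I> \<and> v \<in> I. z I)" if v: "v \<in> pverts G" for v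
    proof (cases "\<exists>J. J \<in> ?\<I> \<and> v \<in> J \<and> 1 \<le> y J")
      case True
      then obtain J where J: "J \<in> ?\<I>" "v \<in> J" "1 \<le> y J" by blast
      have "z J \<le> (\<Sum>I | I \<in> ?\<I> \<and> v \<in> I. z I)"
        using J fin y0 by (intro member_le_sum) (auto simp: z_def)
      with J show ?thesis by (simp add: z_def)
    next
      case False
      then have "(\<Sum>I | I \<in> ?\<I> \<and> v \<in> I. z I) = (\<Sum>I | I \<in> ?\<I> \<and> v \<in> I. y I)"
        by (intro sum.cong) (auto simp: z_def min_def)
      with y v show ?thesis by (simp add: fractional_colorings_def)
    qed
    then show "z \<in> K"
      using y0 by (auto simp: K_def B_def fractional_colorings_def z_def)
    show "?w z \<le> ?w y"
      by (intro sum_mono) (simp add: z_def)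
  qed
  have "(\<lambda>_. 1) \<in> fractional_colorings G"
  proof -
    have "1 \<le> (\<Sum>I | I \<in> ?\<I> \<and> v \<in> I. 1 :: real)" if "v \<in> pverts G" for v
    proof -
      have "{v} \<in> {I. I \<in> ?\<I> \<and> v \<in> I}"
        using that pair_no_loops by (force simp: independent_sets_def)
      moreover have "finite {I. I \<in> ?\<I> \<and> v \<in> I}"
        using fin by simp
      ultimately have "0 < card {I. I \<in> ?\<I> \<and> v \<in> I}"
        by (auto simp: card_gt_0_iff)
      then show ?thesis by simp
    qed
    then show ?thesis by (simp add: fractional_colorings_def)
  qed
  with clip have "K \<noteq> {}" by blast
  moreover have "continuous_on K ?w"
    by (intro continuous_on_sum continuous_on_subset[OF coord]) simp
  ultimately obtain x where x: "x \<in> K" "\<And>z. z \<in> K \<Longrightarrow> ?w x \<le> ?w z"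
    using continuous_attains_inf[OF compact] by blast
  have min: "?w x \<le> ?w y" if "y \<in> fractional_colorings G" for y
    using clip[OF that] x(2) by force
  have mem: "x \<in> fractional_colorings G"
    using x(1) by (simp add: K_def)
  have "fractional_chromatic_number G = ?w x"
    unfolding fractional_chromatic_number_def using mem min
    by (intro cInf_eq_minimum) auto
  with mem min show thesis by (intro that) auto
qed

end

theory Submission
  imports Defs
begin

text \<open>
  Take layers \<open>V\<^sub>0, \<dots>, V\<^sub>k\<^sub>-\<^sub>1\<close> with \<open>|V\<^sub>j| = M / d\<^sub>j\<close>, where the \<open>d\<^sub>j\<close> grow doubly exponentially
  (so \<open>k\<close> is of order \<open>log log n\<close>), and let every vertex of \<open>V\<^sub>i\<close> choose one uniformly random neighbour
  in each \<open>V\<^sub>j\<close> with \<open>j > i\<close>.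

  Let \<open>\<alpha>\<^sub>j\<close> be the density of an independent set in \<open>V\<^sub>j\<close>. A vertex of \<open>V\<^sub>i\<close> misses the part of the set in
  later layers with probability \<open>\<Prod>\<^sub>j\<^sub>>\<^sub>i (1 - \<alpha>\<^sub>j) \<le> exp (- \<Sum>\<^sub>j\<^sub>>\<^sub>i \<alpha>\<^sub>j)\<close>, and the layers shrink so fast that a
  Chernoff bound survives the union bound over all sets in later layers. So the \<open>\<alpha>\<^sub>j\<close> sum to at most
  \<open>ln k + O(1)\<close>, and weighting every layer by total weight 1 gives fractional chromatic number at least
  \<open>k / (ln k + O(1))\<close>.

  A 4-regular subgraph with \<open>h\<^sub>j\<close> vertices in \<open>V\<^sub>j\<close>, \<open>h\<close> in total, which receive \<open>e\<^sub>j\<close> edges from earlier layers,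
  satisfies \<open>e\<^sub>j \<le> 4 h\<^sub>j\<close>, \<open>e\<^sub>j + h\<^sub>j \<le> h\<close> and \<open>\<Sum> e\<^sub>j = 2 h\<close>. The expected number of such subgraphs
  is about \<open>\<Prod> y\<^sub>j ^ (e\<^sub>j - h\<^sub>j)\<close> with \<open>y\<^sub>j = h\<^sub>j / |V\<^sub>j|\<close>, which is about \<open>(h / M) ^ h \<cdot> \<Prod> d\<^sub>j ^ (e\<^sub>j - h\<^sub>j)\<close>. The first two
  constraints give \<open>e\<^sub>j - h\<^sub>j \<le> 3 h / 5\<close>, so the last layer that matters, where \<open>d\<^sub>j\<close> is roughly at most
  \<open>M / h\<close>, contributes at most about \<open>(M / h) ^ (3 h / 5)\<close>, and the earlier layers are negligible.
\<close>

section \<open>The first moment estimate\<close>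

text \<open>In the notation above \<open>d\<^sub>j = q ^ (100 \<cdot> 10 ^ j)\<close> and \<open>M = q ^ (100 \<cdot> 10 ^ k)\<close> with \<open>q = 2 ^ k\<close>.\<close>

definition layer_size :: "nat \<Rightarrow> nat \<Rightarrow> nat" where
  "layer_size k j = 2 ^ (k * (100 * 10 ^ k - 100 * 10 ^ j))"

lemma layer_size_pos: "0 < layer_size k j"
  by (simp add: layer_size_def)

lemma ln_layer_size:
  assumes "j < k"
  shows "ln (real (layer_size k j)) = real k * ln 2 * (100 * 10 ^ k - 100 * 10 ^ j)"
proof -
  have "(10::nat) ^ j \<le> 10 ^ k"
    using assms by (intro power_increasing) auto
  then have "real (100 * 10 ^ k - 100 * 10 ^ j :: nat) = 100 * 10 ^ k - 100 * 10 ^ j"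
    by (subst of_nat_diff) auto
  then show ?thesis
    by (simp add: layer_size_def ln_realpow)
qed

lemma layer_size_antimono:
  assumes "i \<le> j"
  shows "layer_size k j \<le> layer_size k i"
proof -
  have "(10::nat) ^ i \<le> 10 ^ j"
    using assms by (intro power_increasing) auto
  then show ?thesis
    unfolding layer_size_def by (intro power_increasing mult_le_mono2 diff_le_mono2) auto
qed

text \<open>The exponents differ by \<open>k * 900 * 10 ^ i\<close>. The part \<open>3 * k\<close>
  of this is all that the later union bound over subsets of the smaller layers uses.\<close>

lemma layer_size_Suc:
  assumes "Suc i < k"
  shows "layer_size k (Suc i) * 2 ^ (3 * k) \<le> layer_size k i"
proof -
  have 1: "(10::nat) ^ Suc i \<le> 10 ^ k"
    using assms by (intro power_increasing) auto
  have "(1::nat) \<le> 10 ^ i" by simp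
  with 1 have "100 * 10 ^ k - 100 * 10 ^ Suc i + 3 \<le> 100 * 10 ^ k - (100 * 10 ^ i :: nat)"
    unfolding power_Suc by linarith
  then have "k * (100 * 10 ^ k - 100 * 10 ^ Suc i + 3) \<le> k * (100 * 10 ^ k - (100 * 10 ^ i :: nat))"
    by (rule mult_le_mono2)
  then have "(2::nat) ^ (k * (100 * 10 ^ k - 100 * 10 ^ Suc i + 3)) \<le> layer_size k i"
    unfolding layer_size_def by (intro power_increasing) auto
  then show ?thesis
    by (simp add: layer_size_def power_add algebra_simps)
qed

lemma layer_size_ge:
  assumes "i < k"
  shows "2 ^ (3 * k) \<le> layer_size k i"
proof -
  have "(10::nat) ^ Suc i \<le> 10 ^ k"
    using assms by (intro power_increasing) auto
  moreover have "(1::nat) \<le> 10 ^ i" by simp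
  ultimately have "3 \<le> 100 * 10 ^ k - (100 * 10 ^ i :: nat)"
    unfolding power_Suc by linarith
  then have "3 * k \<le> k * (100 * 10 ^ k - (100 * 10 ^ i :: nat))"
    by (metis mult.commute mult_le_mono2)
  then show ?thesis
    unfolding layer_size_def by (intro power_increasing) auto
qed

section \<open>The exponent inequality: entropy and degree excess\<close>

lemma sum_powers_of_ten_le:
  fixes B :: real
  assumes "finite A" "\<And>j. j \<in> A \<Longrightarrow> 10 ^ j \<le> B" "0 \<le> B"
  shows "(\<Sum>j\<in>A. 10 ^ j) \<le> 10 / 9 * B"
proof (cases "A = {}")
  case False
  define m where "m = Max A"
  have "m \<in> A" "A \<subseteq> {..m}"
    using False assms(1) by (auto simp: m_def)
  then have "(\<Sum>j\<in>A. 10 ^ j) \<le> (\<Sum>j\<le>m. 10 ^ j :: real)"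
    by (intro sum_mono2) auto
  also have "\<dots> \<le> 10 / 9 * 10 ^ m"
    by (induction m) auto
  also have "\<dots> \<le> 10 / 9 * B"
    using assms(2)[OF \<open>m \<in> A\<close>] by simp
  finally show ?thesis .
qed (use assms in simp)

text \<open>The entropy of the distribution \<open>h j / s\<close> on \<open>k\<close> points is at
  most \<open>ln k\<close>. Termwise, \<open>ln x \<le> x - 1\<close> at
  \<open>x = s / (k * h j)\<close> leaves errors that sum to zero.\<close>

lemma gibbs_uniform:
  fixes h :: "nat \<Rightarrow> nat" and k :: nat
  defines "s \<equiv> \<Sum>j<k. h j"
  assumes "0 < s" "0 < k"
  shows "- (\<Sum>j<k. real (h j) * ln (h j / s)) \<le> s * ln k"
proof -
  have step: "- (real (h j) * ln (h j / s)) - h j * ln k \<le> s / k - h j" for j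
  proof (cases "h j = 0")
    case False
    have "- (real (h j) * ln (h j / s)) - h j * ln k = h j * ln (s / (k * h j))"
      using False \<open>0 < s\<close> \<open>0 < k\<close> by (simp add: ln_div ln_mult algebra_simps)
    also have "\<dots> \<le> h j * (s / (k * h j) - 1)"
      using False \<open>0 < s\<close> \<open>0 < k\<close> by (intro mult_left_mono ln_le_minus_one) auto
    also have "\<dots> = s / k - h j"
      using False by (simp add: field_simps)
    finally show ?thesis .
  qed (use \<open>0 < s\<close> in simp)
  have "(\<Sum>j<k. - (real (h j) * ln (h j / s)) - h j * ln k) \<le> (\<Sum>j<k. s / k - h j)"
    by (intro sum_mono step)
  also have "\<dots> = 0"
    using assms by (simp add: sum_subtractf s_def)
  finally show ?thesis
    by (simp add: sum_subtractf sum_negf s_def flip: sum_distrib_right)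
qed

lemma linear_le_power_two:
  fixes x :: nat
  assumes "7 \<le> x"
  shows "15 * x \<le> 2 ^ x"
  using assms by (induction x rule: dec_induct) auto

text \<open>
  Here \<open>\<mu>\<close> is the logarithm of \<open>M / s\<close> to base \<open>q = 2 ^ k\<close>. Layers with \<open>100 \<cdot> 10 ^ j \<le> 5 / 4 \<cdot> \<mu>\<close> contribute a geometric
  sum; in every other layer \<open>h j \<le> layer_size k j\<close> makes \<open>h j / s\<close> tiny.
\<close>

lemma degree_excess_bound:
  fixes h e :: "nat \<Rightarrow> nat" and k :: nat
  defines "s \<equiv> \<Sum>j<k. h j"
  defines "Q \<equiv> real k * ln 2"
  defines "\<mu> \<equiv> 100 * 10 ^ k - ln (real s) / Q"
  assumes "0 < s"
    and h: "\<And>j. j < k \<Longrightarrow> h j \<le> layer_size k j"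
    and e: "\<And>j. j < k \<Longrightarrow> e j \<le> 4 * h j"
    and eh: "\<And>j. j < k \<Longrightarrow> e j + h j \<le> s"
  shows "99 \<le> \<mu>" and "(\<Sum>j<k. (real (e j) - h j) * (100 * 10 ^ j)) \<le> s * (1 + 5 / 6 * \<mu>)"
proof -
  have "k > 0"
    using \<open>0 < s\<close> by (auto simp: s_def intro: gr0I)
  then have "Q > 0"
    by (simp add: Q_def)
  \<comment> \<open>No layer exceeds \<open>layer_size k 0 = q ^ (100 * 10 ^ k - 100)\<close>, and
    the factor \<open>k \<le> q\<close> costs one unit, hence 99.\<close>
  have "real s \<le> real k * layer_size k 0"
  proof -
    have "s \<le> (\<Sum>j<k. layer_size k 0)"
      unfolding s_def using h layer_size_antimono[of 0 _ k] by (intro sum_mono) (force intro: order_trans)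
    then show ?thesis
      by (simp flip: of_nat_mult)
  qed
  then have "ln (real s) \<le> ln (real k * layer_size k 0)"
    using \<open>0 < s\<close> by (subst ln_le_cancel_iff) (auto intro: less_le_trans)
  also have "\<dots> = ln (real k) + ln (real (layer_size k 0))"
    using \<open>k > 0\<close> layer_size_pos[of k 0] by (simp add: ln_mult)
  also have "ln (real (layer_size k 0)) = Q * (100 * 10 ^ k - 100)"
    using ln_layer_size[of 0 k] \<open>k > 0\<close> by (simp add: Q_def)
  also have "ln (real k) \<le> ln (2 ^ k)"
    using \<open>k > 0\<close> by (simp add: of_nat_less_two_power less_imp_le)
  also have "ln (2 ^ k) = Q"
    by (simp add: Q_def ln_realpow)
  finally have "ln (real s) \<le> Q * (100 * 10 ^ k - 99)"
    by (simp add: algebra_simps)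
  then have "ln (real s) / Q \<le> 100 * 10 ^ k - 99"
    using \<open>Q > 0\<close> by (simp add: field_simps)
  then show mu: "99 \<le> \<mu>"
    by (simp add: \<mu>_def)
  \<comment> \<open>Outside \<open>A\<close>, \<open>100 * 10 ^ j - \<mu>\<close> exceeds
    \<open>20 * 10 ^ j\<close>, which forces \<open>h j \<le> s / q ^ (20 * 10 ^ j)\<close>. Each
    such layer then costs at most \<open>s / k\<close>, hence the summand \<open>1 / k\<close>
    below.\<close>
  define A where "A = {j. j < k \<and> 10 ^ j \<le> \<mu> / 80}"
  have step: "(real (e j) - h j) * (100 * 10 ^ j) \<le> s * ((if j \<in> A then 60 * 10 ^ j else 0 :: real) + 1 / k)"
    if "j < k" for j
  proof (cases "j \<in> A")
    case True
    have "real (e j) \<le> 4 * real (h j)" "real (e j) + real (h j) \<le> real s"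
      using e[OF that] eh[OF that] by linarith+
    \<comment> \<open>Twice the first inequality plus three times the second.\<close>
    then have "5 * (real (e j) - h j) \<le> 3 * real s"
      by argo
    then have "(real (e j) - h j) * (100 * 10 ^ j) \<le> (3 / 5 * s) * (100 * 10 ^ j)"
      by (intro mult_right_mono) auto
    moreover have "0 \<le> real s / k"
      by simp
    ultimately have "(real (e j) - h j) * (100 * 10 ^ j) \<le> (3 / 5 * s) * (100 * 10 ^ j) + real s / k"
      by linarith
    with True show ?thesis
      by (simp add: algebra_simps)
  next
    case False
    \<comment> \<open>Since \<open>q ^ (20 * 10 ^ j) = 2 ^ x\<close>, the term is at most
      \<open>300 * 10 ^ j * s / 2 ^ x = s / k * (15 * x / 2 ^ x)\<close>.\<close>
    define x where "x = k * (20 * 10 ^ j)"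
    have j: "\<mu> < 80 * 10 ^ j"
      using False that by (simp add: A_def)
    have hj: "real (h j) \<le> s / 2 ^ x"
    proof (cases "h j = 0")
      case False
      have "ln (real (h j)) \<le> ln (real (layer_size k j))"
        using h[OF that] False by (subst ln_le_cancel_iff) (auto simp: layer_size_pos)
      also have "\<dots> = Q * (\<mu> - 100 * 10 ^ j) + ln s"
        using \<open>Q > 0\<close> by (simp add: ln_layer_size[OF that] Q_def[symmetric] \<mu>_def field_simps)
      also have "\<dots> \<le> Q * (- (20 * 10 ^ j)) + ln s"
        using j \<open>Q > 0\<close> by (intro add_right_mono mult_left_mono) auto
      also have "\<dots> = ln (s / 2 ^ x)"
        using \<open>0 < s\<close> by (simp add: ln_div ln_realpow x_def Q_def)
      finally show ?thesis
        using \<open>0 < s\<close> False by (subst (asm) ln_le_cancel_iff) auto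
    qed simp
    have "7 \<le> x"
    proof -
      have "1 * (20 * 1) \<le> x"
        unfolding x_def using \<open>k > 0\<close> by (intro mult_mono) auto
      then show ?thesis by simp
    qed
    then have x: "real (15 * x) \<le> 2 ^ x"
      using linear_le_power_two[of x] by (metis of_nat_le_iff of_nat_numeral of_nat_power)
    have "(real (e j) - h j) * (100 * 10 ^ j) \<le> (3 * real (h j)) * (100 * 10 ^ j)"
      using e[OF that] by (intro mult_right_mono) auto
    also have "\<dots> \<le> (3 * (s / 2 ^ x)) * (100 * 10 ^ j)"
      using hj by (intro mult_right_mono mult_left_mono) auto
    also have "\<dots> = s / k * (real (15 * x) / 2 ^ x)"
      using \<open>k > 0\<close> by (simp add: x_def field_simps)
    also have "\<dots> \<le> s / k * 1"
      using x by (intro mult_left_mono) auto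
    finally show ?thesis
      using False by simp
  qed
  have "(\<Sum>j<k. (real (e j) - h j) * (100 * 10 ^ j)) \<le>
      (\<Sum>j<k. s * ((if j \<in> A then 60 * 10 ^ j else 0 :: real) + 1 / k))"
    by (intro sum_mono step) simp
  also have "\<dots> = s * ((\<Sum>j<k. if j \<in> A then 60 * 10 ^ j else 0 :: real) + 1)"
    using \<open>k > 0\<close> by (simp add: sum.distrib flip: sum_distrib_left)
  also have "(\<Sum>j<k. if j \<in> A then 60 * 10 ^ j else 0 :: real) = 60 * (\<Sum>j\<in>A. 10 ^ j)"
  proof -
    have "{..<k} \<inter> A = A"
      by (auto simp: A_def)
    then show ?thesis
      by (simp add: sum.If_cases sum_distrib_left)
  qed
  \<comment> \<open>Here \<open>60 * (10 / 9) / 80 = 5 / 6\<close>. It is decisive that this is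
    below 1, because the gain set against it is \<mu> per vertex.\<close>
  also have "real s * (60 * (\<Sum>j\<in>A. 10 ^ j) + 1) \<le> s * (60 * (10 / 9 * (\<mu> / 80)) + 1)"
    using mu by (intro mult_left_mono add_right_mono sum_powers_of_ten_le) (auto simp: A_def)
  finally show "(\<Sum>j<k. (real (e j) - h j) * (100 * 10 ^ j)) \<le> s * (1 + 5 / 6 * \<mu>)"
    by (simp add: algebra_simps)
qed

text \<open>The left side is the probability that all prescribed choices stay inside the vertex set;
  the product kept on the right will pay for choosing that set. In logarithms,
  \<open>l j = ln (h j / s) - Q * \<mu> + Q * (100 * 10 ^ j)\<close>. The first term costs at most
  the entropy \<open>s * ln k \<le> s * Q\<close>, the second gains \<open>Q * \<mu> * s\<close>
  because the excesses \<open>e j - h j\<close> sum to \<open>s\<close>, and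
  \<open>degree_excess_bound\<close> controls the third. The total is at most
  \<open>s * Q * (2 - \<mu> / 6)\<close>.\<close>

lemma density_power_bound:
  fixes h e :: "nat \<Rightarrow> nat" and k :: nat
  defines "s \<equiv> \<Sum>j<k. h j"
  assumes h: "\<And>j. j < k \<Longrightarrow> h j \<le> layer_size k j"
    and e: "\<And>j. j < k \<Longrightarrow> e j \<le> 4 * h j"
    and eh: "\<And>j. j < k \<Longrightarrow> e j + h j \<le> s"
    and sum_e: "(\<Sum>j<k. e j) = 2 * s"
  shows "(\<Prod>j<k. (h j / layer_size k j) ^ e j) \<le>
    (\<Prod>j<k. (h j / layer_size k j) ^ h j) / 2 ^ (5 * k * s)"
proof (cases "s = 0")
  case True
  then have "h j = 0 \<and> e j = 0" if "j < k" for j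
    using e[of j] that by (auto simp: s_def)
  with True show ?thesis by simp
next
  case False
  then have "s > 0" by simp
  define Q where "Q = real k * ln 2"
  define \<mu> where "\<mu> = 100 * 10 ^ k - ln (real s) / Q"
  have "k > 0"
    using \<open>0 < s\<close> by (auto simp: s_def intro: gr0I)
  then have "Q > 0"
    by (simp add: Q_def)
  define l where "l = (\<lambda>j. ln (h j / layer_size k j))"
  note excess = degree_excess_bound[of h k e, folded s_def, OF \<open>s > 0\<close> h e eh, folded Q_def, folded \<mu>_def]
  have e0: "e j = 0" if "j < k" "h j = 0" for j
    using e[of j] that by simp
  \<comment> \<open>If \<open>h j = 0\<close>, the identity holds whatever \<open>l j\<close> is,
    because the exponent vanishes too; for \<open>e j\<close> this follows from
    \<open>e j \<le> 4 * h j\<close>.\<close>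
  have pow: "(h j / layer_size k j) ^ m = exp (real m * l j)" if "j < k" "h j = 0 \<Longrightarrow> m = 0" for j m
  proof (cases "h j = 0")
    case False
    then show ?thesis
      using layer_size_pos[of k j] by (simp add: l_def exp_of_nat_mult)
  qed (use that in simp)
  have l: "(real (e j) - h j) * l j \<le>
      - (real (h j) * ln (h j / s)) - Q * \<mu> * (real (e j) - h j) + Q * ((real (e j) - h j) * (100 * 10 ^ j))"
    if "j < k" for j
  proof (cases "h j = 0")
    case False
    have "l j = ln (real (h j)) - ln (real (layer_size k j))"
      using False layer_size_pos[of k j] by (simp add: l_def ln_div)
    also have "\<dots> = ln (h j / s) - Q * \<mu> + Q * (100 * 10 ^ j)"
      using False \<open>0 < s\<close> \<open>Q > 0\<close>
      by (simp add: ln_layer_size[OF that] Q_def[symmetric] ln_div \<mu>_def field_simps)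
    finally have l_eq: "l j = ln (h j / s) - Q * \<mu> + Q * (100 * 10 ^ j)" .
    have "(real (e j) - h j) * l j = real (e j) * ln (h j / s) - (real (h j) * ln (h j / s))
        - Q * \<mu> * (real (e j) - h j) + Q * ((real (e j) - h j) * (100 * 10 ^ j))"
      unfolding l_eq by (simp add: algebra_simps)
    moreover have "h j \<le> s"
      using that eh[OF that] by simp
    then have "real (e j) * ln (h j / s) \<le> 0"
      using False \<open>0 < s\<close> by (intro mult_nonneg_nonpos) (auto simp: field_simps)
    ultimately show ?thesis by linarith
  qed (use e[OF that] in simp)
  have diff: "(\<Sum>j<k. real (e j) - h j) = s"
  proof -
    have "(\<Sum>j<k. real (e j)) = 2 * s" "(\<Sum>j<k. real (h j)) = s"
      using sum_e by (simp_all add: s_def flip: of_nat_sum)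
    then show ?thesis by (simp add: sum_subtractf)
  qed
  have "(\<Sum>j<k. (real (e j) - h j) * l j) \<le> (\<Sum>j<k. - (real (h j) * ln (h j / s))
      - Q * \<mu> * (real (e j) - h j) + Q * ((real (e j) - h j) * (100 * 10 ^ j)))"
    by (intro sum_mono l) simp
  also have "\<dots> = - (\<Sum>j<k. real (h j) * ln (h j / s)) - Q * \<mu> * (\<Sum>j<k. real (e j) - h j)
      + Q * (\<Sum>j<k. (real (e j) - h j) * (100 * 10 ^ j))"
    by (simp add: sum.distrib sum_subtractf sum_negf right_diff_distrib flip: sum_distrib_left)
  also have "\<dots> \<le> s * ln k - Q * \<mu> * s + Q * (s * (1 + 5 / 6 * \<mu>))"
    unfolding diff using excess(2) \<open>Q > 0\<close> gibbs_uniform[of h k] \<open>0 < s\<close> \<open>0 < k\<close>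
    by (intro add_mono diff_right_mono mult_left_mono) (simp_all add: s_def)
  also have "\<dots> \<le> s * Q - Q * \<mu> * s + Q * (s * (1 + 5 / 6 * \<mu>))"
  proof -
    have "ln (real k) \<le> ln (2 ^ k)"
      using \<open>k > 0\<close> by (simp add: of_nat_less_two_power less_imp_le)
    also have "\<dots> = Q"
      by (simp add: Q_def ln_realpow)
    finally show ?thesis
      by (intro add_right_mono diff_right_mono mult_left_mono) auto
  qed
  also have "real s * Q - Q * \<mu> * s + Q * (s * (1 + 5 / 6 * \<mu>)) = (s * Q) * (2 - \<mu> / 6)"
    by (simp add: algebra_simps)
  also have "\<dots> \<le> (s * Q) * (- 5)"
    using excess(1) \<open>Q > 0\<close> by (intro mult_left_mono) auto
  finally have main: "(\<Sum>j<k. real (e j) * l j) \<le> (\<Sum>j<k. real (h j) * l j) - 5 * s * Q"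
    by (simp add: sum_subtractf left_diff_distrib right_diff_distrib mult_ac)
  have "(\<Prod>j<k. (h j / layer_size k j) ^ e j) = exp (\<Sum>j<k. real (e j) * l j)"
    unfolding exp_sum[OF finite_lessThan] using e0 by (intro prod.cong refl pow) auto
  also have "\<dots> \<le> exp ((\<Sum>j<k. real (h j) * l j) - 5 * s * Q)"
    using main by simp
  also have "\<dots> = (\<Prod>j<k. (h j / layer_size k j) ^ h j) / 2 ^ (5 * k * s)"
  proof -
    have "exp (5 * real s * Q) = exp (real (5 * k * s) * ln 2)"
      by (simp add: Q_def)
    also have "\<dots> = 2 ^ (5 * k * s)"
      by (subst exp_of_nat_mult) simp
    finally have expQ: "exp (5 * real s * Q) = 2 ^ (5 * k * s)" .
    have "exp (\<Sum>j<k. real (h j) * l j) = (\<Prod>j<k. (h j / layer_size k j) ^ h j)"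
      unfolding exp_sum[OF finite_lessThan] by (intro prod.cong refl pow[symmetric]) auto
    then show ?thesis
      by (simp add: exp_diff expQ)
  qed
  finally show ?thesis .
qed

section \<open>Weighted sums over vertex sets\<close>

lemma sum_Pow_card:
  fixes g :: "nat \<Rightarrow> 'b :: comm_semiring_1"
  assumes "finite V"
  shows "(\<Sum>S\<in>Pow V. g (card S)) = (\<Sum>m\<le>card V. of_nat (card V choose m) * g m)"
proof -
  have "(\<Sum>S\<in>Pow V. g (card S)) = (\<Sum>m\<le>card V. \<Sum>S | S \<in> Pow V \<and> card S = m. g (card S))"
    using assms by (intro sum.group[symmetric]) (auto intro: card_mono)
  also have "\<dots> = (\<Sum>m\<le>card V. of_nat (card V choose m) * g m)"
    using assms by (intro sum.cong) (auto simp: n_subsets)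
  finally show ?thesis .
qed

text \<open>\<open>m ^ m / fact m\<close> is a single term of the exponential series at
  \<open>m\<close>, and \<open>exp 1 < 4\<close>.\<close>

lemma power_self_le_fact: "real m ^ m \<le> 4 ^ m * fact m"
proof -
  have "real m ^ m /\<^sub>R fact m = (\<Sum>n\<in>{m}. real m ^ n /\<^sub>R fact n)"
    by simp
  also have "\<dots> \<le> (\<Sum>n. real m ^ n /\<^sub>R fact n)"
    by (intro sum_le_suminf summable_exp_generic) auto
  also have "\<dots> = exp (real m)"
    by (simp add: exp_def)
  also have "\<dots> = exp 1 ^ m"
    using exp_of_nat_mult[of m "1::real"] by simp
  also have "\<dots> \<le> 4 ^ m"
    using e_less_272 by (intro power_mono) auto
  finally show ?thesis
    by (simp add: field_simps)
qed

text \<open>The share of one layer in the union bound over vertex sets. Since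
  \<open>N choose m \<le> N ^ m / fact m\<close>, the sets of size \<open>m\<close> contribute at
  most \<open>(4 / 8) ^ m\<close>; the 8 is there to make this series geometric.\<close>

lemma sum_Pow_density_le:
  assumes "finite V"
  shows "(\<Sum>S\<in>Pow V. (card S / (8 * card V)) ^ card S) \<le> (2::real)"
proof -
  define N where "N = card V"
  have step: "real (N choose m) * (m / (8 * N)) ^ m \<le> (1 / 2) ^ m" if "m \<le> N" for m
  proof (cases "N = 0")
    case False
    have "real ((N choose m) * fact m) \<le> real (N ^ m)"
      using binomial_fact_pow[of N m] by (simp only: of_nat_le_iff)
    then have "real (N choose m) * fact m \<le> real N ^ m"
      by simp
    then have "real (N choose m) * fact m * real m ^ m \<le> real N ^ m * (4 ^ m * fact m)"
      by (intro mult_mono power_self_le_fact) auto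
    then have "real (N choose m) * real m ^ m \<le> real N ^ m * 4 ^ m"
      by simp
    then have "real (N choose m) * real m ^ m / (8 * real N) ^ m \<le> real N ^ m * 4 ^ m / (8 * real N) ^ m"
      by (rule divide_right_mono) simp
    also have "\<dots> = 4 ^ m / 8 ^ m"
      using False by (simp add: power_mult_distrib)
    also have "\<dots> = (4 / 8) ^ m"
      by (rule power_divide[symmetric])
    finally show ?thesis
      by (simp add: power_divide)
  qed (use that in simp)
  have "(\<Sum>S\<in>Pow V. (card S / (8 * card V)) ^ card S) = (\<Sum>m\<le>N. real (N choose m) * (m / (8 * N)) ^ m)"
    using sum_Pow_card[OF assms, of "\<lambda>m. (m / (8 * card V)) ^ m"] by (simp add: N_def)
  also have "\<dots> \<le> (\<Sum>m\<le>N. (1 / 2) ^ m)"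
    by (intro sum_mono step) simp
  also have "\<dots> \<le> 2"
    by (subst sum_gp0) auto
  finally show ?thesis .
qed

section \<open>Fractional cliques and the recursion for layer densities\<close>

text \<open>Weak linear programming duality: \<open>w / B\<close> is a fractional clique. The sums
  over vertices and over independent sets are exchanged in an optimal fractional coloring.\<close>

lemma fractional_chromatic_number_ge:
  fixes w :: "'a \<Rightarrow> real"
  assumes G: "pair_graph G" and "0 < B"
    and w: "\<And>v. v \<in> pverts G \<Longrightarrow> 0 \<le> w v"
    and indep: "\<And>I. I \<in> independent_sets G \<Longrightarrow> (\<Sum>v\<in>I. w v) \<le> B"
  shows "(\<Sum>v\<in>pverts G. w v) / B \<le> fractional_chromatic_number G"
proof -
  interpret pair_graph G by fact
  obtain x where x: "x \<in> fractional_colorings G"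
    and eq: "fractional_chromatic_number G = (\<Sum>I\<in>independent_sets G. x I)"
    using fractional_chromatic_number_attained[OF G] by metis
  note fin = finite_independent_sets[OF G]
  have "(\<Sum>v\<in>pverts G. w v) \<le> (\<Sum>v\<in>pverts G. w v * (\<Sum>I | I \<in> independent_sets G \<and> v \<in> I. x I))"
  proof (rule sum_mono)
    fix v assume "v \<in> pverts G"
    then have "w v * 1 \<le> w v * (\<Sum>I | I \<in> independent_sets G \<and> v \<in> I. x I)"
      using x w by (intro mult_left_mono) (auto simp: fractional_colorings_def)
    then show "w v \<le> w v * (\<Sum>I | I \<in> independent_sets G \<and> v \<in> I. x I)"
      by simp
  qed
  also have "\<dots> = (\<Sum>v\<in>pverts G. \<Sum>I\<in>independent_sets G. if v \<in> I then w v * x I else 0)"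
    using fin by (auto simp: sum_distrib_left sum.inter_filter intro!: sum.cong)
  also have "\<dots> = (\<Sum>I\<in>independent_sets G. \<Sum>v\<in>pverts G. if v \<in> I then w v * x I else 0)"
    by (rule sum.swap)
  also have "\<dots> = (\<Sum>I\<in>independent_sets G. (\<Sum>v\<in>I. w v) * x I)"
  proof (intro sum.cong refl)
    fix I assume "I \<in> independent_sets G"
    then have "pverts G \<inter> I = I"
      by (auto simp: independent_sets_def)
    then show "(\<Sum>v\<in>pverts G. if v \<in> I then w v * x I else 0) = (\<Sum>v\<in>I. w v) * x I"
      using pair_finite_verts by (simp add: sum.If_cases sum_distrib_right)
  qed
  also have "\<dots> \<le> (\<Sum>I\<in>independent_sets G. B * x I)"
    using x indep by (intro sum_mono mult_right_mono) (auto simp: fractional_colorings_def)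
  finally show ?thesis
    using \<open>0 < B\<close> by (simp add: eq field_simps sum_distrib_left)
qed

lemma sum_le_of_exp_decay:
  fixes \<alpha> :: "nat \<Rightarrow> real"
  assumes "0 < k" and le1: "\<And>i. i < k \<Longrightarrow> \<alpha> i \<le> 1"
    and decay: "\<And>i. i < k \<Longrightarrow> \<alpha> i \<le> 2 * exp (- (\<Sum>j\<in>{i<..<k}. \<alpha> j)) + 1 / k"
  shows "(\<Sum>j<k. \<alpha> j) \<le> ln k + 4"
proof -
  define T where "T i = (\<Sum>j\<in>{i..<k}. \<alpha> j)" for i
  \<comment> \<open>Downwards in \<open>i\<close>: once \<open>T\<close> exceeds \<open>ln k\<close>, every further term is at most \<open>3 / k\<close>.\<close>
  have "T i \<le> ln k + 1 + 3 * (real k - i) / k" if "i \<le> k" for i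
    using that
  proof (induction i rule: inc_induct)
    case base
    then show ?case
      using \<open>0 < k\<close> by (simp add: T_def)
  next
    case (step i)
    have T: "T i = \<alpha> i + T (Suc i)"
      using step.hyps by (simp add: T_def sum.atLeast_Suc_lessThan)
    have nonneg: "0 \<le> 3 * (real k - i) / k"
      using step.hyps by simp
    \<comment> \<open>If the tail is at most \<open>ln k\<close>, one more term adds at most 1,
      without recourse to the induction hypothesis. The \<open>k\<close> increments of
      \<open>3 / k\<close> supply the rest of the constant 4.\<close>
    show ?case
    proof (cases "T (Suc i) \<le> ln k")
      case True
      with le1[OF step.hyps(2)] T nonneg show ?thesis by linarith
    next
      case False
      have "{i<..<k} = {Suc i..<k}"
        by auto
      then have "\<alpha> i \<le> 2 * exp (- T (Suc i)) + 1 / k"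
        using decay[OF step.hyps(2)] by (simp add: T_def)
      also have "exp (- T (Suc i)) \<le> exp (- ln k)"
        using False by simp
      also have "exp (- ln k) = 1 / k"
        using \<open>0 < k\<close> by (simp add: exp_minus inverse_eq_divide)
      finally have "\<alpha> i \<le> 3 / k"
        by simp
      with step.IH T have "T i \<le> ln k + 1 + 3 * (real k - Suc i) / k + 3 / k"
        by simp
      then show ?thesis
        by (simp add: add_divide_distrib diff_divide_distrib algebra_simps)
    qed
  qed
  from this[of 0] show ?thesis
    using \<open>0 < k\<close> by (simp add: T_def atLeast0LessThan)
qed

section \<open>The random layered graph\<close>

text \<open>
  \<open>f v j\<close> is the neighbour that \<open>v\<close> chooses in layer \<open>j\<close>. Vertices of level at least \<open>k\<close> choose nothing and are
  isolated; they pad the graph to the required order.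
\<close>

locale layered =
  fixes U :: "'a set" and lev :: "'a \<Rightarrow> nat" and k :: nat
  assumes finite_U: "finite U"
begin

definition layer :: "nat \<Rightarrow> 'a set" where
  "layer i = {v \<in> U. lev v = i}"

text \<open>Probability is replaced by counting: an event is a subset of this finite product, its
  probability the proportion it occupies, and independence of the choices is the product
  structure.\<close>

definition choices :: "('a \<Rightarrow> nat \<Rightarrow> 'a) set" where
  "choices = (\<Pi>\<^sub>E v\<in>U. \<Pi>\<^sub>E j\<in>{lev v<..<k}. layer j)"

definition forward :: "('a \<Rightarrow> nat \<Rightarrow> 'a) \<Rightarrow> 'a rel" where
  "forward f = {(v, f v j) | v j. v \<in> U \<and> lev v < j \<and> j < k}"

definition graph :: "('a \<Rightarrow> nat \<Rightarrow> 'a) \<Rightarrow> 'a pair_pre_digraph" where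
  "graph f = \<lparr>pverts = U, parcs = forward f \<union> (forward f)\<inverse>\<rparr>"

lemma finite_layer [simp]: "finite (layer i)"
  using finite_U by (simp add: layer_def)

lemma finite_choices: "finite choices"
  using finite_U by (auto simp: choices_def intro!: finite_PiE)

lemma choice_in_layer:
  "f \<in> choices \<Longrightarrow> v \<in> U \<Longrightarrow> lev v < j \<Longrightarrow> j < k \<Longrightarrow> f v j \<in> layer j"
  by (auto simp: choices_def dest!: PiE_mem)

lemma forwardD:
  assumes "f \<in> choices" "(u, v) \<in> forward f"
  shows "u \<in> U" "v \<in> U" "lev u < lev v" "lev v < k" "v = f u (lev v)"
  using assms choice_in_layer[OF assms(1)] by (auto simp: forward_def layer_def)

lemma pair_graph_graph:
  assumes "f \<in> choices"
  shows "pair_graph (graph f)"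
proof
  have sub: "parcs (graph f) \<subseteq> U \<times> U"
    using forwardD[OF assms] by (auto simp: graph_def)
  then show "finite (parcs (graph f))"
    using finite_U finite_subset by blast
  show "finite (pverts (graph f))"
    using finite_U by (simp add: graph_def)
  show "fst e \<in> pverts (graph f)" "snd e \<in> pverts (graph f)" if "e \<in> parcs (graph f)" for e
    using that sub by (auto simp: graph_def)
  show "fst e \<noteq> snd e" if "e \<in> parcs (graph f)" for e
    using that by (cases e) (auto simp: graph_def dest: forwardD(3)[OF assms])
  show "symmetric (graph f)"
    by (auto simp: symmetric_def graph_def sym_def)
qed

subsection \<open>Regular subgraphs\<close>

text \<open>This extracts a certificate for the union bound: \<open>out v\<close> records the layers
  in which the subgraph uses the choice of \<open>v\<close>. There is one choice per layer, so the
  pairs \<open>(v, j)\<close> with \<open>j \<in> out v\<close> correspond to the forward arcs,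
  which are half of all arcs.\<close>

lemma regular_subgraph_profile:
  assumes f: "f \<in> choices" and reg: "has_regular_subgraph r (graph f)" and "r > 0"
  obtains H out where
    "H \<subseteq> {v \<in> U. lev v < k}" "H \<noteq> {}"
    "out \<in> (\<Pi>\<^sub>E v\<in>H. Pow {lev v<..<k})"
    "\<And>v j. v \<in> H \<Longrightarrow> j \<in> out v \<Longrightarrow> f v j \<in> H"
    "\<And>j. j < k \<Longrightarrow> card {v \<in> H. j \<in> out v} \<le> r * card (H \<inter> layer j)"
    "2 * (\<Sum>v\<in>H. card (out v)) = r * card H"
proof -
  from reg obtain K :: "'a pair_pre_digraph" where K: "subgraph K (graph f)" "pverts K \<noteq> {}"
    "pair_graph K" "\<And>v. v \<in> pverts K \<Longrightarrow> out_degree K v = r"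
    by (auto simp: has_regular_subgraph_def regular_graph_def)
  interpret K: pair_graph K by fact
  define H where "H = pverts K"
  define nb where "nb v = {w. (v, w) \<in> parcs K}" for v
  define F where "F = parcs K \<inter> forward f"
  have arcsK: "parcs K \<subseteq> forward f \<union> (forward f)\<inverse>" and "H \<subseteq> U"
    using K(1) by (auto simp: subgraph_def graph_def H_def)
  have finH: "finite H"
    using K.pair_finite_verts by (simp add: H_def)
  have symK: "(v, u) \<in> parcs K" if "(u, v) \<in> parcs K" for u v
    using K.pair_sym_arcs that by (auto simp: symmetric_def sym_def)
  have nbH: "nb v \<subseteq> H" for v
    by (auto simp: nb_def H_def dest: K.in_arcsD2)
  have finnb: "finite (nb v)" for v
    using finH nbH finite_subset by blast
  have deg: "card (nb v) = r" if "v \<in> H" for v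
  proof -
    have "out_arcs K v = Pair v ` nb v"
      by (auto simp: out_arcs_def nb_def)
    then show ?thesis
      using K(4)[of v] that by (simp add: out_degree_def card_image inj_on_def H_def)
  qed
  \<comment> \<open>Vertices of level at least \<open>k\<close> are isolated, so positive degree
    excludes them.\<close>
  have lev_H: "lev v < k" if "v \<in> H" for v
  proof -
    have "nb v \<noteq> {}"
      using deg[OF that] \<open>r > 0\<close> by auto
    then obtain w where "(v, w) \<in> parcs K"
      by (auto simp: nb_def)
    with arcsK show ?thesis
      using forwardD[OF f, of v w] forwardD[OF f, of w v] by auto
  qed
  have "card (parcs K) = card (Sigma H nb)"
    by (rule arg_cong[of _ _ card]) (auto simp: nb_def H_def dest: K.in_arcsD1)
  also have "\<dots> = r * card H"
    using finH finnb deg by (simp add: card_SigmaI)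
  finally have cardK: "card (parcs K) = r * card H" .
  have "finite F"
    using K.pair_finite_arcs by (simp add: F_def)
  have "parcs K = F \<union> F\<inverse>"
    using arcsK symK by (auto simp: F_def)
  moreover have "F \<inter> F\<inverse> = {}"
    by (auto simp: F_def dest!: forwardD(3)[OF f])
  moreover have "card (F\<inverse>) = card F"
  proof -
    have "F\<inverse> = prod.swap ` F" by force
    then show ?thesis by (simp add: card_image)
  qed
  ultimately have cardF: "2 * card F = r * card H"
    using cardK \<open>finite F\<close> by (simp add: card_Un_disjoint)
  define out where "out = (\<lambda>v\<in>H. {j \<in> {lev v<..<k}. (v, f v j) \<in> parcs K})"
  have lev_f: "lev (f v j) = j" if "v \<in> H" "j \<in> out v" for v j
    using that choice_in_layer[OF f, of v j] \<open>H \<subseteq> U\<close> by (auto simp: out_def layer_def)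
  have "bij_betw (\<lambda>(v, j). (v, f v j)) (Sigma H out) F"
  proof (rule bij_betw_byWitness[where f' = "\<lambda>(v, w). (v, lev w)"])
    show "\<forall>a\<in>Sigma H out. (\<lambda>(v, w). (v, lev w)) ((\<lambda>(v, j). (v, f v j)) a) = a"
      using lev_f by auto
    show "\<forall>a\<in>F. (\<lambda>(v, j). (v, f v j)) ((\<lambda>(v, w). (v, lev w)) a) = a"
      using forwardD(5)[OF f] by (auto simp: F_def)
    show "(\<lambda>(v, j). (v, f v j)) ` Sigma H out \<subseteq> F"
      using \<open>H \<subseteq> U\<close> by (auto simp: F_def out_def forward_def) blast
    show "(\<lambda>(v, w). (v, lev w)) ` F \<subseteq> Sigma H out"
      using forwardD[OF f] K.in_arcsD1 by (auto simp: F_def out_def H_def)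
  qed
  then have "card (Sigma H out) = card F"
    by (rule bij_betw_same_card)
  moreover have fin_out: "finite (out v)" if "v \<in> H" for v
    using that by (simp add: out_def)
  ultimately have sum_out: "(\<Sum>v\<in>H. card (out v)) = card F"
    using finH by (simp add: card_SigmaI)
  have in_deg: "card {v \<in> H. j \<in> out v} \<le> r * card (H \<inter> layer j)" if "j < k" for j
  proof -
    \<comment> \<open>Each edge entering layer \<open>j\<close> is charged to its head, where its
      tail is one of \<open>r\<close> neighbours.\<close>
    have "card {v \<in> H. j \<in> out v} \<le> card (Sigma (H \<inter> layer j) nb)"
    proof (rule card_inj_on_le[where f = "\<lambda>v. (f v j, v)"])
      show "inj_on (\<lambda>v. (f v j, v)) {v \<in> H. j \<in> out v}"
        by (auto simp: inj_on_def)
      show "(\<lambda>v. (f v j, v)) ` {v \<in> H. j \<in> out v} \<subseteq> Sigma (H \<inter> layer j) nb"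
        using choice_in_layer[OF f] \<open>H \<subseteq> U\<close> symK
        by (auto simp: out_def nb_def H_def dest: K.in_arcsD2)
      show "finite (Sigma (H \<inter> layer j) nb)"
        using finnb by (intro finite_SigmaI) auto
    qed
    also have "\<dots> = r * card (H \<inter> layer j)"
      using finnb deg by (simp add: card_SigmaI)
    finally show ?thesis .
  qed
  show ?thesis
  proof (rule that[of H out])
    show "H \<subseteq> {v \<in> U. lev v < k}"
      using \<open>H \<subseteq> U\<close> lev_H by auto
    show "H \<noteq> {}"
      using K(2) by (simp add: H_def)
    show "out \<in> (\<Pi>\<^sub>E v\<in>H. Pow {lev v<..<k})"
      by (auto simp: out_def)
    show "f v j \<in> H" if "v \<in> H" "j \<in> out v" for v j
      using that by (auto simp: out_def H_def dest: K.in_arcsD2)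
    show "2 * (\<Sum>v\<in>H. card (out v)) = r * card H"
      using sum_out cardF by simp
  qed (fact in_deg)
qed

text \<open>Each constraint shrinks a single coordinate of a product set from \<open>layer j\<close>
  to \<open>H \<inter> layer j\<close>, so it contributes its own factor.\<close>

lemma card_choices_into:
  assumes H: "H \<subseteq> U" and out: "\<And>v. v \<in> H \<Longrightarrow> out v \<subseteq> {lev v<..<k}"
    and nonempty: "\<And>j. j < k \<Longrightarrow> layer j \<noteq> {}"
  shows "real (card {f \<in> choices. \<forall>v\<in>H. \<forall>j\<in>out v. f v j \<in> H}) =
    card choices * (\<Prod>j<k. (card (H \<inter> layer j) / card (layer j)) ^ card {v \<in> H. j \<in> out v})"
proof -
  define y where "y j = real (card (H \<inter> layer j)) / card (layer j)" for j
  define P where "P v j \<longleftrightarrow> v \<in> H \<and> j \<in> out v" for v j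
  have "{f \<in> choices. \<forall>v\<in>H. \<forall>j\<in>out v. f v j \<in> H} =
      (\<Pi>\<^sub>E v\<in>U. \<Pi>\<^sub>E j\<in>{lev v<..<k}. if P v j then H \<inter> layer j else layer j)"
  proof (intro equalityI subsetI)
    fix f assume f: "f \<in> {f \<in> choices. \<forall>v\<in>H. \<forall>j\<in>out v. f v j \<in> H}"
    then show "f \<in> (\<Pi>\<^sub>E v\<in>U. \<Pi>\<^sub>E j\<in>{lev v<..<k}. if P v j then H \<inter> layer j else layer j)"
      unfolding choices_def P_def PiE_iff by (auto simp: PiE_iff)
  next
    fix f assume f: "f \<in> (\<Pi>\<^sub>E v\<in>U. \<Pi>\<^sub>E j\<in>{lev v<..<k}. if P v j then H \<inter> layer j else layer j)"
    have mem: "f v j \<in> (if P v j then H \<inter> layer j else layer j)" if "v \<in> U" "j \<in> {lev v<..<k}" for v j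
      using f that by (auto dest!: PiE_mem)
    have "f v j \<in> layer j" if "v \<in> U" "j \<in> {lev v<..<k}" for v j
      using mem[OF that] by (auto split: if_splits)
    with f have "f \<in> choices"
      unfolding choices_def PiE_iff by (auto simp: PiE_iff)
    moreover have "f v j \<in> H" if "v \<in> H" "j \<in> out v" for v j
    proof -
      have "v \<in> U" "j \<in> {lev v<..<k}"
        using that H out[OF that(1)] by auto
      from mem[OF this] show ?thesis
        using that by (simp add: P_def)
    qed
    ultimately show "f \<in> {f \<in> choices. \<forall>v\<in>H. \<forall>j\<in>out v. f v j \<in> H}"
      by simp
  qed
  then have "real (card {f \<in> choices. \<forall>v\<in>H. \<forall>j\<in>out v. f v j \<in> H}) =
      (\<Prod>v\<in>U. \<Prod>j\<in>{lev v<..<k}. real (card (if P v j then H \<inter> layer j else layer j)))"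
    using finite_U by (simp add: card_PiE)
  also have "\<dots> = (\<Prod>v\<in>U. \<Prod>j\<in>{lev v<..<k}. card (layer j) * (if P v j then y j else 1))"
    using nonempty by (intro prod.cong) (auto simp: y_def)
  also have "\<dots> = card choices * (\<Prod>v\<in>U. \<Prod>j\<in>{lev v<..<k}. if P v j then y j else 1)"
    using finite_U by (simp add: choices_def card_PiE prod.distrib)
  \<comment> \<open>Outside \<open>{lev v<..<k}\<close> the factor is 1; the inner range becomes
    independent of \<open>v\<close>, so that the products can be swapped.\<close>
  also have "(\<Prod>v\<in>U. \<Prod>j\<in>{lev v<..<k}. if P v j then y j else 1) =
      (\<Prod>v\<in>U. \<Prod>j<k. if P v j then y j else 1)"
    using out by (intro prod.cong refl prod.mono_neutral_left) (auto simp: P_def)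
  also have "\<dots> = (\<Prod>j<k. \<Prod>v\<in>U. if P v j then y j else 1)"
    by (rule prod.swap)
  also have "\<dots> = (\<Prod>j<k. y j ^ card {v \<in> H. j \<in> out v})"
  proof (intro prod.cong refl)
    fix j
    have "U \<inter> {v. P v j} = {v \<in> H. j \<in> out v}"
      using H by (auto simp: P_def)
    then show "(\<Prod>v\<in>U. if P v j then y j else 1) = y j ^ card {v \<in> H. j \<in> out v}"
      using finite_U by (simp add: prod.If_cases)
  qed
  finally show ?thesis
    by (simp add: y_def)
qed

text \<open>A set of vertices of level below \<open>k\<close> amounts to a free choice of its traces
  on the layers. This makes the union bound over \<open>H\<close> factor.\<close>

lemma sum_Pow_layers:
  fixes g :: "nat \<Rightarrow> 'a set \<Rightarrow> real"
  shows "(\<Sum>H\<in>Pow {v \<in> U. lev v < k}. \<Prod>j<k. g j (H \<inter> layer j)) = (\<Prod>j<k. \<Sum>S\<in>Pow (layer j). g j S)"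
proof -
  have "(\<Prod>j<k. \<Sum>S\<in>Pow (layer j). g j S) = (\<Sum>T\<in>(\<Pi>\<^sub>E j\<in>{..<k}. Pow (layer j)). \<Prod>j<k. g j (T j))"
    by (rule prod_sum_PiE) auto
  also have "\<dots> = (\<Sum>H\<in>Pow {v \<in> U. lev v < k}. \<Prod>j<k. g j (H \<inter> layer j))"
  proof (rule sum.reindex_bij_witness[where i = "\<lambda>H. \<lambda>j\<in>{..<k}. H \<inter> layer j" and j = "\<lambda>T. \<Union>j<k. T j"])
    have inter: "(\<Union>j<k. T j) \<inter> layer i = T i" if T: "T \<in> (\<Pi>\<^sub>E j\<in>{..<k}. Pow (layer j))" and "i < k" for T i
    proof -
      have "T j \<subseteq> layer j" if "j < k" for j
        using PiE_mem[OF T] that by auto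
      moreover have "layer i \<inter> layer j = {}" if "i \<noteq> j" for j
        using that by (auto simp: layer_def)
      ultimately show ?thesis
        using \<open>i < k\<close> by fastforce
    qed
    show "(\<lambda>j\<in>{..<k}. (\<Union>j<k. T j) \<inter> layer j) = T" if "T \<in> (\<Pi>\<^sub>E j\<in>{..<k}. Pow (layer j))" for T
      using inter[OF that] that by (auto simp: fun_eq_iff restrict_def PiE_def extensional_def)
    show "(\<Union>j<k. T j) \<in> Pow {v \<in> U. lev v < k}" if "T \<in> (\<Pi>\<^sub>E j\<in>{..<k}. Pow (layer j))" for T
      using that by (fastforce simp: layer_def dest: PiE_mem)
    show "(\<Prod>j<k. g j ((\<Union>j<k. T j) \<inter> layer j)) = (\<Prod>j<k. g j (T j))"
      if "T \<in> (\<Pi>\<^sub>E j\<in>{..<k}. Pow (layer j))" for T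
      using inter[OF that] by (intro prod.cong) auto
    show "(\<Union>j<k. (\<lambda>j\<in>{..<k}. H \<inter> layer j) j) = H" if "H \<in> Pow {v \<in> U. lev v < k}" for H
      using that by (auto simp: layer_def)
  qed auto
  finally show ?thesis ..
qed

lemma card_eq_sum_layers:
  assumes "H \<subseteq> {v \<in> U. lev v < k}"
  shows "card H = (\<Sum>j<k. card (H \<inter> layer j))"
proof -
  have "H = (\<Union>j<k. H \<inter> layer j)"
    using assms by (auto simp: layer_def)
  then have "card H = card (\<Union>j<k. H \<inter> layer j)"
    by simp
  also have "\<dots> = (\<Sum>j<k. card (H \<inter> layer j))"
    by (intro card_UN_disjoint) (auto simp: layer_def finite_U)
  finally show ?thesis .
qed

lemma card_choices_profile_le:
  assumes sizes: "\<And>j. j < k \<Longrightarrow> card (layer j) = layer_size k j"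
    and H: "H \<subseteq> {v \<in> U. lev v < k}"
    and out: "out \<in> (\<Pi>\<^sub>E v\<in>H. Pow {lev v<..<k})"
    and deg: "\<And>j. j < k \<Longrightarrow> card {v \<in> H. j \<in> out v} \<le> 4 * card (H \<inter> layer j)"
    and sum_out: "(\<Sum>v\<in>H. card (out v)) = 2 * card H"
  shows "real (card {f \<in> choices. \<forall>v\<in>H. \<forall>j\<in>out v. f v j \<in> H}) \<le>
    card choices * (\<Prod>j<k. (card (H \<inter> layer j) / layer_size k j) ^ card (H \<inter> layer j)) / 2 ^ (5 * k * card H)"
proof -
  have outD: "out v \<subseteq> {lev v<..<k}" if "v \<in> H" for v
    using PiE_mem[OF out that] by simp
  have finH: "finite H"
    using H finite_U by (auto intro: finite_subset)
  note cardH = card_eq_sum_layers[OF H]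
  have "real (card {f \<in> choices. \<forall>v\<in>H. \<forall>j\<in>out v. f v j \<in> H}) =
      card choices * (\<Prod>j<k. (card (H \<inter> layer j) / card (layer j)) ^ card {v \<in> H. j \<in> out v})"
  proof (rule card_choices_into)
    show "layer j \<noteq> {}" if "j < k" for j
      using sizes[OF that] layer_size_pos[of k j] by auto
  qed (use H outD in auto)
  also have "\<dots> = card choices * (\<Prod>j<k. (card (H \<inter> layer j) / layer_size k j) ^ card {v \<in> H. j \<in> out v})"
    by (intro arg_cong2[of _ _ _ _ "(*)"] prod.cong refl) (simp add: sizes)
  also have "\<dots> \<le> card choices *
      ((\<Prod>j<k. (card (H \<inter> layer j) / layer_size k j) ^ card (H \<inter> layer j)) / 2 ^ (5 * k * card H))"
    unfolding cardH
  proof (intro mult_left_mono density_power_bound)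
    show "card (H \<inter> layer j) \<le> layer_size k j" if "j < k" for j
      using card_mono[of "layer j" "H \<inter> layer j"] sizes[OF that] by simp
    show "card {v \<in> H. j \<in> out v} + card (H \<inter> layer j) \<le> (\<Sum>j<k. card (H \<inter> layer j))" for j
    proof -
      \<comment> \<open>No vertex of layer \<open>j\<close> chooses within its own layer, so the
        tails of the edges into layer \<open>j\<close> are disjoint from
        \<open>H \<inter> layer j\<close>.\<close>
      have "lev v \<notin> out v" if "v \<in> H" for v
        using outD[OF that] by auto
      then have "card {v \<in> H. j \<in> out v} + card (H \<inter> layer j) = card ({v \<in> H. j \<in> out v} \<union> (H \<inter> layer j))"
        using finH by (intro card_Un_disjoint[symmetric]) (auto simp: layer_def)
      also have "\<dots> \<le> card H"
        using finH by (intro card_mono) auto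
      finally show ?thesis
        by (simp add: cardH)
    qed
    show "(\<Sum>j<k. card {v \<in> H. j \<in> out v}) = 2 * (\<Sum>j<k. card (H \<inter> layer j))"
    proof -
      have "(\<Sum>j<k. card {v \<in> H. j \<in> out v}) = (\<Sum>j<k. \<Sum>v\<in>H. if j \<in> out v then 1 else 0)"
        using finH by (simp add: sum.If_cases Int_def)
      also have "\<dots> = (\<Sum>v\<in>H. \<Sum>j<k. if j \<in> out v then 1 else 0)"
        by (rule sum.swap)
      also have "\<dots> = (\<Sum>v\<in>H. card (out v))"
      proof (intro sum.cong refl)
        fix v assume "v \<in> H"
        then have "{..<k} \<inter> out v = out v"
          using outD[OF \<open>v \<in> H\<close>] by auto
        then show "(\<Sum>j<k. if j \<in> out v then 1 else 0) = card (out v)"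
          by (simp add: sum.If_cases)
      qed
      finally show ?thesis
        by (simp add: sum_out cardH)
    qed
  qed (use deg in auto)
  finally show ?thesis
    by simp
qed

text \<open>For \<open>card H = h\<close> there are at most \<open>2 ^ (k * h)\<close> functions
  \<open>out\<close>, against a gain of \<open>2 ^ (5 * k * h)\<close>. From the remaining
  \<open>2 ^ (4 * k * h)\<close>, a factor \<open>8 ^ h\<close> makes the sum over each layer at
  most 2, and a factor \<open>2 ^ (3 * k)\<close> beats the resulting product
  \<open>2 ^ k\<close>.\<close>

lemma card_regular_subgraph_choices_le:
  assumes sizes: "\<And>j. j < k \<Longrightarrow> card (layer j) = layer_size k j" and "3 \<le> k"
  shows "real (card {f \<in> choices. has_regular_subgraph 4 (graph f)}) \<le> card choices / 2 ^ (2 * k)"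
proof -
  define W where "W = {v \<in> U. lev v < k}"
  define Outs where "Outs H = {out \<in> (\<Pi>\<^sub>E v\<in>H. Pow {lev v<..<k}).
    (\<forall>j<k. card {v \<in> H. j \<in> out v} \<le> 4 * card (H \<inter> layer j)) \<and> (\<Sum>v\<in>H. card (out v)) = 2 * card H}" for H
  define E where "E H out = {f \<in> choices. \<forall>v\<in>H. \<forall>j\<in>out v. f v j \<in> H}" for H out
  define D where "D H = (\<Prod>j<k. (card (H \<inter> layer j) / layer_size k j) ^ card (H \<inter> layer j))" for H
  have "finite W"
    using finite_U by (simp add: W_def)
  have fin_E: "finite (E H out)" for H out
    using finite_choices by (simp add: E_def)
  have PiE_fin: "finite (\<Pi>\<^sub>E v\<in>H. Pow {lev v<..<k})" if "H \<subseteq> W" for H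
    using finite_subset[OF that \<open>finite W\<close>] by (intro finite_PiE) auto
  have fin_Outs: "finite (Outs H)" if "H \<subseteq> W" for H
    using PiE_fin[OF that] by (simp add: Outs_def)
  \<comment> \<open>The empty set must be left out, since its certificate holds for every
    \<open>f\<close>; \<open>h \<ge> 1\<close> is what later yields the factor
    \<open>2 ^ (3 * k)\<close>.\<close>
  have "{f \<in> choices. has_regular_subgraph 4 (graph f)} \<subseteq> (\<Union>H\<in>Pow W - {{}}. \<Union>out\<in>Outs H. E H out)"
  proof
    fix f assume "f \<in> {f \<in> choices. has_regular_subgraph 4 (graph f)}"
    then have f: "f \<in> choices" "has_regular_subgraph 4 (graph f)"
      by auto
    show "f \<in> (\<Union>H\<in>Pow W - {{}}. \<Union>out\<in>Outs H. E H out)"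
    proof (rule regular_subgraph_profile[OF f])
      fix H out
      assume "H \<subseteq> {v \<in> U. lev v < k}" "H \<noteq> {}" "out \<in> (\<Pi>\<^sub>E v\<in>H. Pow {lev v<..<k})"
        "\<And>v j. v \<in> H \<Longrightarrow> j \<in> out v \<Longrightarrow> f v j \<in> H"
        "\<And>j. j < k \<Longrightarrow> card {v \<in> H. j \<in> out v} \<le> 4 * card (H \<inter> layer j)"
        "2 * (\<Sum>v\<in>H. card (out v)) = 4 * card H"
      then have "H \<in> Pow W - {{}}" "out \<in> Outs H" "f \<in> E H out"
        using f by (simp_all add: W_def Outs_def E_def)
      then show ?thesis
        by blast
    qed simp
  qed
  then have "card {f \<in> choices. has_regular_subgraph 4 (graph f)} \<le>
      card (\<Union>H\<in>Pow W - {{}}. \<Union>out\<in>Outs H. E H out)"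
    using \<open>finite W\<close> fin_E fin_Outs by (intro card_mono) auto
  also have "\<dots> \<le> (\<Sum>H\<in>Pow W - {{}}. card (\<Union>out\<in>Outs H. E H out))"
    using \<open>finite W\<close> by (intro card_UN_le) auto
  also have "\<dots> \<le> (\<Sum>H\<in>Pow W - {{}}. \<Sum>out\<in>Outs H. card (E H out))"
    using fin_Outs by (intro sum_mono card_UN_le) auto
  finally have "real (card {f \<in> choices. has_regular_subgraph 4 (graph f)}) \<le>
      (\<Sum>H\<in>Pow W - {{}}. \<Sum>out\<in>Outs H. real (card (E H out)))"
    by (simp flip: of_nat_sum)
  also have "\<dots> \<le> (\<Sum>H\<in>Pow W - {{}}. card choices / 2 ^ (3 * k) *
      (\<Prod>j<k. (card (H \<inter> layer j) / (8 * card (layer j))) ^ card (H \<inter> layer j)))"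
  proof (intro sum_mono)
    fix H assume "H \<in> Pow W - {{}}"
    then have H: "H \<subseteq> W" "H \<noteq> {}"
      by auto
    have finH: "finite H"
      using H(1) \<open>finite W\<close> finite_subset by blast
    define h where "h = card H"
    have "1 \<le> h"
      using H finH by (simp add: h_def Suc_leI card_gt_0_iff)
    have D_nonneg: "0 \<le> D H"
      by (auto simp: D_def intro!: prod_nonneg)
    have "card (Outs H) \<le> card (\<Pi>\<^sub>E v\<in>H. Pow {lev v<..<k})"
      using PiE_fin[OF H(1)] by (intro card_mono) (auto simp: Outs_def)
    also have "\<dots> = (\<Prod>v\<in>H. 2 ^ card {lev v<..<k})"
      using finH by (simp add: card_PiE card_Pow)
    also have "\<dots> \<le> (\<Prod>v\<in>H. 2 ^ k)"
      by (intro prod_mono) (auto intro: power_increasing)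
    also have "\<dots> = 2 ^ (k * h)"
      by (simp add: h_def power_mult)
    finally have card_Outs: "real (card (Outs H)) \<le> 2 ^ (k * h)"
      by (metis of_nat_le_iff of_nat_numeral of_nat_power)
    have "(\<Sum>out\<in>Outs H. real (card (E H out))) \<le> (\<Sum>out\<in>Outs H. card choices * D H / 2 ^ (5 * k * h))"
      unfolding E_def D_def h_def using H(1)
      by (intro sum_mono card_choices_profile_le sizes) (auto simp: Outs_def W_def)
    also have "\<dots> = card (Outs H) * (card choices * D H / 2 ^ (5 * k * h))"
      by simp
    also have "\<dots> \<le> 2 ^ (k * h) * (card choices * D H / 2 ^ (5 * k * h))"
      using card_Outs D_nonneg by (intro mult_right_mono) auto
    also have "\<dots> = card choices * D H / 2 ^ (4 * k * h)"
    proof -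
      have "(2::real) ^ (5 * k * h) = 2 ^ (k * h) * 2 ^ (4 * k * h)"
        by (simp flip: power_add)
      then show ?thesis by simp
    qed
    also have "\<dots> \<le> card choices * D H / (2 ^ (3 * k) * 8 ^ h)"
    proof (rule divide_left_mono)
      have "3 * h \<le> k * h" "k * 1 \<le> k * h"
        using \<open>3 \<le> k\<close> \<open>1 \<le> h\<close> by (auto intro: mult_le_mono)
      then have "3 * k + 3 * h \<le> 4 * k * h"
        unfolding mult.assoc by linarith
      then have "(2::real) ^ (3 * k + 3 * h) \<le> 2 ^ (4 * k * h)"
        by (intro power_increasing) auto
      then show "(2::real) ^ (3 * k) * 8 ^ h \<le> 2 ^ (4 * k * h)"
        by (simp add: power_add power_mult)
    qed (use D_nonneg in auto)
    also have "\<dots> = card choices / 2 ^ (3 * k) * (D H / 8 ^ h)"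
      by simp
    also have "D H / 8 ^ h = (\<Prod>j<k. (card (H \<inter> layer j) / (8 * card (layer j))) ^ card (H \<inter> layer j))"
    proof -
      have "(8::real) ^ h = (\<Prod>j<k. 8 ^ card (H \<inter> layer j))"
        using card_eq_sum_layers[OF H(1)[unfolded W_def]] by (simp add: h_def power_sum)
      then show ?thesis
        unfolding D_def by (simp flip: prod_dividef)
          (intro prod.cong refl, simp add: sizes power_divide power_mult_distrib)
    qed
    finally show "(\<Sum>out\<in>Outs H. real (card (E H out))) \<le> card choices / 2 ^ (3 * k) *
      (\<Prod>j<k. (card (H \<inter> layer j) / (8 * card (layer j))) ^ card (H \<inter> layer j))" .
  qed
  \<comment> \<open>With that factor secured, the empty set is added back so that the sum factors
    over the layers.\<close>
  also have "\<dots> \<le> (\<Sum>H\<in>Pow W. card choices / 2 ^ (3 * k) *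
      (\<Prod>j<k. (card (H \<inter> layer j) / (8 * card (layer j))) ^ card (H \<inter> layer j)))"
    using \<open>finite W\<close> by (intro sum_mono2) (auto intro!: mult_nonneg_nonneg prod_nonneg)
  also have "\<dots> = card choices / 2 ^ (3 * k) *
      (\<Prod>j<k. \<Sum>S\<in>Pow (layer j). (card S / (8 * card (layer j))) ^ card S)"
    unfolding sum_distrib_left[symmetric] W_def
    by (subst sum_Pow_layers[of "\<lambda>j S. (card S / (8 * card (layer j))) ^ card S", symmetric]) simp
  also have "\<dots> \<le> card choices / 2 ^ (3 * k) * (\<Prod>j<k. 2)"
    by (intro mult_left_mono prod_mono conjI sum_Pow_density_le sum_nonneg) auto
  also have "\<dots> = card choices / 2 ^ (2 * k)"
  proof -
    have "(2::real) ^ (3 * k) = 2 ^ (2 * k) * 2 ^ k"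
      by (simp flip: power_add)
    then show ?thesis by simp
  qed
  finally show ?thesis .
qed

subsection \<open>Independent sets\<close>

text \<open>If \<open>S j\<close> is the part of an independent set in each later layer
  \<open>j\<close>, then its part in layer \<open>i\<close> lies in this set.\<close>

definition avoiding :: "('a \<Rightarrow> nat \<Rightarrow> 'a) \<Rightarrow> nat \<Rightarrow> (nat \<Rightarrow> 'a set) \<Rightarrow> 'a set" where
  "avoiding f i S = {v \<in> layer i. \<forall>j\<in>{i<..<k}. f v j \<notin> S j}"

text \<open>For nonempty layers and \<open>S j \<subseteq> layer j\<close>, this is the probability
  that a fixed vertex of layer \<open>i\<close> chooses no member of any later
  \<open>S j\<close>.\<close>

definition codensity :: "nat \<Rightarrow> (nat \<Rightarrow> 'a set) \<Rightarrow> real" where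
  "codensity i S = (\<Prod>j\<in>{i<..<k}. 1 - card (S j) / card (layer j))"

lemma codensity_nonneg:
  assumes "\<And>j. j \<in> {i<..<k} \<Longrightarrow> S j \<subseteq> layer j"
  shows "0 \<le> codensity i S"
proof -
  have "card (S j) / card (layer j) \<le> 1" if "j \<in> {i<..<k}" for j
    using card_mono[OF finite_layer assms[OF that]] by (simp add: divide_le_eq_1 card_gt_0_iff)
  then show ?thesis
    unfolding codensity_def by (intro prod_nonneg) simp
qed

text \<open>Vertices choose independently, so the moment generating function factors over them. With
  \<open>p\<close> the codensity, a vertex of layer \<open>i\<close> contributes
  \<open>1 + p * (exp 1 - 1) \<le> exp (2 * p)\<close>, any other vertex 1.\<close>

lemma sum_exp_avoiding_le:
  assumes nonempty: "\<And>j. j < k \<Longrightarrow> layer j \<noteq> {}"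
    and S: "\<And>j. j \<in> {i<..<k} \<Longrightarrow> S j \<subseteq> layer j"
  shows "(\<Sum>f\<in>choices. exp (card (avoiding f i S))) \<le> card choices * exp (card (layer i) * (2 * codensity i S))"
proof -
  define B where "B v = (\<Pi>\<^sub>E j\<in>{lev v<..<k}. layer j)" for v
  define P where "P v y \<longleftrightarrow> v \<in> layer i \<and> (\<forall>j\<in>{i<..<k}. y j \<notin> S j)" for v and y :: "nat \<Rightarrow> 'a"
  define p where "p = codensity i S"
  have "0 \<le> p"
    unfolding p_def using S by (rule codensity_nonneg)
  have finB: "finite (B v)" for v
    by (auto simp: B_def intro: finite_PiE)
  have e: "exp 1 - 1 \<le> (2::real)"
    using e_less_272 by simp
  have "exp (card (avoiding f i S)) = (\<Prod>v\<in>U. if P v (f v) then exp 1 else 1 :: real)" for f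
  proof -
    have "U \<inter> {v. P v (f v)} = avoiding f i S"
      by (auto simp: P_def avoiding_def layer_def)
    then show ?thesis
      using finite_U exp_of_nat_mult[of "card (avoiding f i S)" "1::real"] by (simp add: prod.If_cases)
  qed
  then have "(\<Sum>f\<in>choices. exp (card (avoiding f i S))) =
      (\<Sum>f\<in>PiE U B. \<Prod>v\<in>U. if P v (f v) then exp 1 else 1 :: real)"
    by (simp add: choices_def B_def[abs_def])
  also have "\<dots> = (\<Prod>v\<in>U. \<Sum>y\<in>B v. if P v y then exp 1 else 1)"
    using finite_U finB by (intro prod_sum_PiE[symmetric]) auto
  also have "\<dots> \<le> (\<Prod>v\<in>U. card (B v) * (if v \<in> layer i then exp (2 * p) else 1))"
  proof (rule prod_mono, intro conjI)
    fix v assume "v \<in> U"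
    show "0 \<le> (\<Sum>y\<in>B v. if P v y then exp 1 else 1 :: real)"
      by (intro sum_nonneg) auto
    show "(\<Sum>y\<in>B v. if P v y then exp 1 else 1) \<le> card (B v) * (if v \<in> layer i then exp (2 * p) else 1)"
    proof (cases "v \<in> layer i")
      case True
      then have lev: "lev v = i"
        by (simp add: layer_def)
      have "{y \<in> B v. P v y} = (\<Pi>\<^sub>E j\<in>{i<..<k}. layer j - S j)"
        using True by (auto simp: B_def P_def lev PiE_iff extensional_def)
      then have "real (card {y \<in> B v. P v y}) = (\<Prod>j\<in>{i<..<k}. real (card (layer j - S j)))"
        by (simp add: card_PiE)
      also have "\<dots> = (\<Prod>j\<in>{i<..<k}. card (layer j) * (1 - card (S j) / card (layer j)))"
      proof (intro prod.cong refl)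
        fix j assume j: "j \<in> {i<..<k}"
        then have "card (layer j) > 0"
          using nonempty by (simp add: card_gt_0_iff)
        moreover have "real (card (layer j - S j)) = card (layer j) - real (card (S j))"
          using S[OF j] card_mono[OF finite_layer S[OF j]] finite_subset[OF S[OF j]]
          by (simp add: card_Diff_subset)
        ultimately show "real (card (layer j - S j)) = card (layer j) * (1 - card (S j) / card (layer j))"
          by (simp add: field_simps)
      qed
      also have "\<dots> = card (B v) * p"
        by (simp add: prod.distrib B_def lev card_PiE p_def codensity_def)
      finally have cardP: "real (card {y \<in> B v. P v y}) = card (B v) * p" .
      have "(\<Sum>y\<in>B v. if P v y then exp 1 else 1) = (\<Sum>y\<in>B v. 1 + (if P v y then exp 1 - 1 else 0 :: real))"
        by (intro sum.cong) auto
      also have "\<dots> = card (B v) + card {y \<in> B v. P v y} * (exp 1 - 1)"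
        using finB by (simp add: sum.distrib sum.If_cases Int_def)
      also have "\<dots> = card (B v) * (1 + p * (exp 1 - 1))"
        by (simp add: cardP algebra_simps)
      also have "\<dots> \<le> card (B v) * (1 + p * 2)"
        using e \<open>0 \<le> p\<close> by (intro mult_left_mono add_left_mono) auto
      also have "\<dots> \<le> card (B v) * exp (2 * p)"
        using exp_ge_add_one_self[of "2 * p"] by (intro mult_left_mono) (auto simp: mult.commute)
      finally show ?thesis
        using True by simp
    qed (simp add: P_def)
  qed
  also have "\<dots> = card choices * exp (2 * p) ^ card (layer i)"
  proof -
    have "U \<inter> layer i = layer i"
      by (auto simp: layer_def)
    then show ?thesis
      using finite_U by (simp add: prod.distrib prod.If_cases choices_def B_def card_PiE)
  qed
  also have "\<dots> = card choices * exp (card (layer i) * (2 * codensity i S))"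
    by (simp add: p_def exp_of_nat_mult)
  finally show ?thesis .
qed

text \<open>Markov's inequality for the exponential of the number of avoiding vertices.\<close>

lemma card_many_avoiding_le:
  fixes \<epsilon> :: real
  assumes nonempty: "\<And>j. j < k \<Longrightarrow> layer j \<noteq> {}"
    and S: "\<And>j. j \<in> {i<..<k} \<Longrightarrow> S j \<subseteq> layer j"
  shows "card {f \<in> choices. card (layer i) * (2 * codensity i S + \<epsilon>) < card (avoiding f i S)}
    \<le> card choices * exp (- (\<epsilon> * card (layer i)))"
proof -
  define c where "c = card (layer i) * (2 * codensity i S + \<epsilon>)"
  define Bad where "Bad = {f \<in> choices. c < card (avoiding f i S)}"
  have "card Bad * exp c = (\<Sum>f\<in>Bad. exp c)"
    by simp
  also have "\<dots> \<le> (\<Sum>f\<in>Bad. exp (card (avoiding f i S)))"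
    by (intro sum_mono) (auto simp: Bad_def)
  also have "\<dots> \<le> (\<Sum>f\<in>choices. exp (card (avoiding f i S)))"
    using finite_choices by (intro sum_mono2) (auto simp: Bad_def)
  also have "\<dots> \<le> card choices * exp (card (layer i) * (2 * codensity i S))"
    by (rule sum_exp_avoiding_le[OF nonempty S])
  finally have "card Bad \<le> card choices * exp (card (layer i) * (2 * codensity i S)) / exp c"
    by (simp add: field_simps)
  also have "\<dots> = card choices * exp (card (layer i) * (2 * codensity i S) - c)"
    by (simp add: exp_diff)
  also have "card (layer i) * (2 * codensity i S) - c = - (\<epsilon> * card (layer i))"
    by (simp add: c_def algebra_simps)
  finally show ?thesis
    by (simp add: Bad_def c_def)
qed

text \<open>Let \<open>N = layer_size k i\<close>. The later layers have at most
  \<open>N / (2 * k)\<close> vertices in total, so there are at most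
  \<open>exp (N / (2 * k))\<close> families \<open>S\<close>, and each is bad with probability at
  most \<open>exp (- N / k)\<close>. What remains is at most \<open>1 / (2 * k)\<close> for every
  \<open>i\<close>.\<close>

lemma card_exists_many_avoiding_le:
  assumes sizes: "\<And>j. j < k \<Longrightarrow> card (layer j) = layer_size k j" and "3 \<le> k"
  shows "card {f \<in> choices. \<exists>i<k. \<exists>S. (\<forall>j\<in>{i<..<k}. S j \<subseteq> layer j) \<and>
      layer_size k i * (2 * codensity i S + 1 / k) < card (avoiding f i S)} \<le> card choices / (2::real)"
proof -
  define Bad where "Bad i S = {f \<in> choices. layer_size k i * (2 * codensity i S + 1 / k) < card (avoiding f i S)}"
    for i S
  define \<S> where "\<S> i = (\<Pi>\<^sub>E j\<in>{i<..<k}. Pow (layer j))" for i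
  have fin_Bad: "finite (Bad i S)" for i S
    using finite_choices by (simp add: Bad_def)
  have fin_S: "finite (\<S> i)" for i
    by (auto simp: \<S>_def intro: finite_PiE)
  have nonempty: "layer j \<noteq> {}" if "j < k" for j
    using sizes[OF that] layer_size_pos[of k j] by auto
  \<comment> \<open>Only the values of \<open>S\<close> on later layers matter; restricting to them
    leaves finitely many families to count.\<close>
  have restrict_Bad: "Bad i (restrict S {i<..<k}) = Bad i S" for i S
  proof -
    have "codensity i (restrict S {i<..<k}) = codensity i S"
      unfolding codensity_def by (intro prod.cong) auto
    moreover have "avoiding f i (restrict S {i<..<k}) = avoiding f i S" for f
      by (auto simp: avoiding_def)
    ultimately show ?thesis
      by (simp add: Bad_def)
  qed
  have "{f \<in> choices. \<exists>i<k. \<exists>S. (\<forall>j\<in>{i<..<k}. S j \<subseteq> layer j) \<and>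
      layer_size k i * (2 * codensity i S + 1 / k) < card (avoiding f i S)} \<subseteq> (\<Union>i<k. \<Union>S\<in>\<S> i. Bad i S)"
    (is "?X \<subseteq> _")
  proof
    fix f assume "f \<in> ?X"
    then obtain i S where iS: "i < k" "\<forall>j\<in>{i<..<k}. S j \<subseteq> layer j" "f \<in> Bad i S"
      by (auto simp: Bad_def)
    then have "restrict S {i<..<k} \<in> \<S> i" "f \<in> Bad i (restrict S {i<..<k})"
      unfolding restrict_Bad by (auto simp: \<S>_def)
    with \<open>i < k\<close> show "f \<in> (\<Union>i<k. \<Union>S\<in>\<S> i. Bad i S)"
      by blast
  qed
  then have "card ?X \<le> card (\<Union>i<k. \<Union>S\<in>\<S> i. Bad i S)"
    using fin_Bad fin_S by (intro card_mono) auto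
  also have "\<dots> \<le> (\<Sum>i<k. card (\<Union>S\<in>\<S> i. Bad i S))"
    by (intro card_UN_le) auto
  also have "\<dots> \<le> (\<Sum>i<k. \<Sum>S\<in>\<S> i. card (Bad i S))"
    using fin_S by (intro sum_mono card_UN_le) auto
  finally have "real (card ?X) \<le> (\<Sum>i<k. \<Sum>S\<in>\<S> i. real (card (Bad i S)))"
    by (simp flip: of_nat_sum)
  also have "\<dots> \<le> (\<Sum>i<k. card choices / (2 * real k))"
  proof (intro sum_mono)
    fix i assume "i \<in> {..<k}"
    then have "i < k" by simp
    define N where "N = real (layer_size k i)"
    \<comment> \<open>The first bound gives \<open>k * (N / 2 ^ (3 * k)) \<le> N / (2 * k)\<close>,
      the second \<open>2 * k \<le> N / (2 * k)\<close>.\<close>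
    have pow: "2 * real k * k \<le> 2 ^ (3 * k)" "4 * real k * k \<le> 2 ^ (3 * k)"
    proof -
      have k: "real k \<le> 2 ^ k"
        by (simp add: of_nat_less_two_power less_imp_le)
      have "(2::real) ^ 2 \<le> 2 ^ k"
        using \<open>3 \<le> k\<close> by (intro power_increasing) auto
      then have four: "4 \<le> (2::real) ^ k"
        by simp
      have "4 * real k * k \<le> 2 ^ k * 2 ^ k * 2 ^ k"
        using k four by (intro mult_mono) auto
      also have "\<dots> = 2 ^ (3 * k)"
        by (simp flip: power_add)
      finally show "4 * real k * k \<le> 2 ^ (3 * k)" .
      moreover have "2 * real k * k \<le> 4 * real k * k"
        by (intro mult_right_mono) auto
      ultimately show "2 * real k * k \<le> 2 ^ (3 * k)"
        by linarith
    qed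
    have "2 ^ (3 * k) \<le> N"
      using layer_size_ge[OF \<open>i < k\<close>] unfolding N_def by (metis of_nat_le_iff of_nat_numeral of_nat_power)
    with pow(2) have N: "4 * real k * k \<le> N"
      by linarith
    have later: "(\<Sum>j\<in>{i<..<k}. real (layer_size k j)) \<le> N / (2 * k)"
    proof (cases "Suc i < k")
      case True
      have "(\<Sum>j\<in>{i<..<k}. real (layer_size k j)) \<le> (\<Sum>j\<in>{i<..<k}. real (layer_size k (Suc i)))"
        by (intro sum_mono) (auto intro: layer_size_antimono)
      also have "\<dots> \<le> k * real (layer_size k (Suc i))"
        by (auto intro!: mult_right_mono)
      also have "\<dots> \<le> k * (N / 2 ^ (3 * k))"
      proof -
        have "real (layer_size k (Suc i)) * 2 ^ (3 * k) \<le> N"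
          using layer_size_Suc[OF True] unfolding N_def
          by (metis of_nat_le_iff of_nat_mult of_nat_numeral of_nat_power)
        then show ?thesis
          by (intro mult_left_mono) (auto simp: field_simps)
      qed
      also have "\<dots> \<le> N / (2 * k)"
        using mult_left_mono[OF pow(1), of N] \<open>3 \<le> k\<close> by (simp add: N_def field_simps)
      finally show ?thesis .
    next
      case False
      then have "{i<..<k} = {}" by auto
      then show ?thesis by (simp add: N_def)
    qed
    have "real (card (\<S> i)) = 2 ^ (\<Sum>j\<in>{i<..<k}. layer_size k j)"
      using sizes by (simp add: \<S>_def card_PiE card_Pow power_sum)
    also have "\<dots> \<le> exp 1 ^ (\<Sum>j\<in>{i<..<k}. layer_size k j)"
      using exp_ge_add_one_self[of 1] by (intro power_mono) auto
    also have "\<dots> = exp (\<Sum>j\<in>{i<..<k}. real (layer_size k j))"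
      by (simp flip: exp_of_nat_mult)
    also have "\<dots> \<le> exp (N / (2 * k))"
      using later by simp
    finally have card_S: "real (card (\<S> i)) \<le> exp (N / (2 * k))" .
    have "(\<Sum>S\<in>\<S> i. real (card (Bad i S))) \<le> (\<Sum>S\<in>\<S> i. card choices * exp (- (1 / k * N)))"
    proof (intro sum_mono)
      fix S assume "S \<in> \<S> i"
      then have "S j \<subseteq> layer j" if "j \<in> {i<..<k}" for j
        using that by (auto simp: \<S>_def dest: PiE_mem)
      from card_many_avoiding_le[OF nonempty this, where i = i and \<epsilon> = "1 / real k"]
      show "real (card (Bad i S)) \<le> card choices * exp (- (1 / k * N))"
        by (simp add: Bad_def N_def sizes[OF \<open>i < k\<close>])
    qed
    also have "\<dots> = card (\<S> i) * (card choices * exp (- (1 / k * N)))"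
      by simp
    also have "\<dots> \<le> exp (N / (2 * k)) * (card choices * exp (- (1 / k * N)))"
      using card_S by (intro mult_right_mono) auto
    also have "\<dots> = card choices / exp (N / (2 * k))"
    proof -
      have "N / k = N / (2 * k) + N / (2 * k)"
        by simp
      then have "exp (N / k) = exp (N / (2 * k)) * exp (N / (2 * k))"
        by (simp only: exp_add)
      then show ?thesis
        by (simp add: exp_minus field_simps)
    qed
    also have "\<dots> \<le> card choices / (2 * real k)"
    proof (rule divide_left_mono)
      have "2 * real k \<le> N / (2 * k)"
        using N \<open>3 \<le> k\<close> by (simp add: field_simps)
      also have "\<dots> \<le> exp (N / (2 * k))"
        using exp_ge_add_one_self[of "N / (2 * k)"] by linarith
      finally show "2 * real k \<le> exp (N / (2 * k))" .
    qed (use \<open>3 \<le> k\<close> in auto)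
    finally show "(\<Sum>S\<in>\<S> i. real (card (Bad i S))) \<le> card choices / (2 * real k)" .
  qed
  also have "\<dots> = card choices / 2"
    using \<open>3 \<le> k\<close> by simp
  finally show ?thesis .
qed

text \<open>The hypothesis \<open>few\<close> is applied to the traces of \<open>I\<close> itself,
  and \<open>1 - \<alpha> \<le> exp (- \<alpha>)\<close> turns the codensity into the decay required
  by \<open>sum_le_of_exp_decay\<close>.\<close>

lemma independent_set_density_sum_le:
  assumes f: "f \<in> choices" and "0 < k"
    and sizes: "\<And>j. j < k \<Longrightarrow> card (layer j) = layer_size k j"
    and few: "\<And>i S. i < k \<Longrightarrow> (\<And>j. j \<in> {i<..<k} \<Longrightarrow> S j \<subseteq> layer j) \<Longrightarrow>
      card (avoiding f i S) \<le> layer_size k i * (2 * codensity i S + 1 / k)"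
    and I: "I \<in> independent_sets (graph f)"
  shows "(\<Sum>j<k. card (I \<inter> layer j) / layer_size k j) \<le> ln k + 4"
proof (rule sum_le_of_exp_decay)
  fix i assume "i < k"
  define \<alpha> where "\<alpha> j = real (card (I \<inter> layer j)) / layer_size k j" for j
  have le1: "\<alpha> j \<le> 1" if "j < k" for j
    using card_mono[of "layer j" "I \<inter> layer j"] sizes[OF that] layer_size_pos[of k j]
    by (simp add: \<alpha>_def divide_le_eq_1)
  from le1[OF \<open>i < k\<close>] show "card (I \<inter> layer i) / layer_size k i \<le> (1::real)"
    by (simp add: \<alpha>_def)
  have "I \<inter> layer i \<subseteq> avoiding f i (\<lambda>j. I \<inter> layer j)"
    using I by (auto simp: independent_sets_def graph_def forward_def avoiding_def layer_def)
  then have "real (card (I \<inter> layer i)) \<le> card (avoiding f i (\<lambda>j. I \<inter> layer j))"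
    by (intro of_nat_mono card_mono) (auto simp: avoiding_def)
  also have "\<dots> \<le> layer_size k i * (2 * codensity i (\<lambda>j. I \<inter> layer j) + 1 / k)"
    using \<open>i < k\<close> by (intro few) auto
  finally have "\<alpha> i \<le> 2 * codensity i (\<lambda>j. I \<inter> layer j) + 1 / k"
    using layer_size_pos[of k i] by (simp add: \<alpha>_def field_simps)
  moreover have "codensity i (\<lambda>j. I \<inter> layer j) \<le> exp (- (\<Sum>j\<in>{i<..<k}. \<alpha> j))"
  proof -
    have "codensity i (\<lambda>j. I \<inter> layer j) = (\<Prod>j\<in>{i<..<k}. 1 - \<alpha> j)"
      unfolding codensity_def \<alpha>_def using sizes by (intro prod.cong) auto
    also have "\<dots> \<le> (\<Prod>j\<in>{i<..<k}. exp (- \<alpha> j))"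
      using le1 exp_ge_add_one_self[of "- \<alpha> _"] by (intro prod_mono) auto
    finally show ?thesis
      by (simp add: exp_sum sum_negf[symmetric])
  qed
  ultimately show "card (I \<inter> layer i) / layer_size k i \<le>
      2 * exp (- (\<Sum>j\<in>{i<..<k}. card (I \<inter> layer j) / layer_size k j)) + 1 / k"
    by (simp add: \<alpha>_def)
qed (use \<open>0 < k\<close> in auto)

section \<open>A choice that avoids both kinds of failure\<close>

lemma exists_choices:
  assumes sizes: "\<And>j. j < k \<Longrightarrow> card (layer j) = layer_size k j" and "3 \<le> k"
  obtains f where "f \<in> choices" "\<not> has_regular_subgraph 4 (graph f)"
    "k / (ln k + 4) \<le> fractional_chromatic_number (graph f)"
proof -
  define A where "A = {f \<in> choices. has_regular_subgraph 4 (graph f)}"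
  define B where "B = {f \<in> choices. \<exists>i<k. \<exists>S. (\<forall>j\<in>{i<..<k}. S j \<subseteq> layer j) \<and>
      layer_size k i * (2 * codensity i S + 1 / k) < card (avoiding f i S)}"
  have "choices \<noteq> {}"
  proof -
    have "layer j \<noteq> {}" if "j < k" for j
      using sizes[OF that] layer_size_pos[of k j] by auto
    then show ?thesis
      by (simp add: choices_def PiE_eq_empty_iff)
  qed
  then have pos: "0 < real (card choices)"
    using finite_choices by (simp add: card_gt_0_iff)
  have "real (card (A \<union> B)) \<le> real (card A) + real (card B)"
    using card_Un_le[of A B] by (simp flip: of_nat_add)
  also have "\<dots> \<le> card choices / 2 ^ (2 * k) + card choices / 2"
    unfolding A_def B_def
    by (intro add_mono card_regular_subgraph_choices_le card_exists_many_avoiding_le sizes \<open>3 \<le> k\<close>)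
  \<comment> \<open>The proportions of failures are at most \<open>1 / 2 ^ (2 * k) < 1 / 2\<close>
    and \<open>1 / 2\<close>, so a good \<open>f\<close> remains.\<close>
  also have "\<dots> < card choices / 2 + card choices / 2"
  proof -
    have "(2::real) ^ 1 < 2 ^ (2 * k)"
      using \<open>3 \<le> k\<close> by (intro power_strict_increasing) auto
    then show ?thesis
      using pos by (intro add_strict_right_mono divide_strict_left_mono) auto
  qed
  finally have "card (A \<union> B) < card choices"
    by simp
  moreover have "A \<union> B \<subseteq> choices"
    by (auto simp: A_def B_def)
  ultimately obtain f where f: "f \<in> choices" "f \<notin> A" "f \<notin> B"
    by (metis Un_iff order_less_irrefl subsetI subset_antisym)
  have few: "card (avoiding f i S) \<le> layer_size k i * (2 * codensity i S + 1 / k)"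
    if "i < k" "\<And>j. j \<in> {i<..<k} \<Longrightarrow> S j \<subseteq> layer j" for i S
  proof (rule ccontr)
    assume "\<not> ?thesis"
    then have "\<exists>i<k. \<exists>S. (\<forall>j\<in>{i<..<k}. S j \<subseteq> layer j) \<and>
        layer_size k i * (2 * codensity i S + 1 / k) < card (avoiding f i S)"
      using that by (intro exI[of _ i] conjI exI[of _ S] ballI) (simp_all add: not_le)
    with f(1) have "f \<in> B"
      by (simp add: B_def)
    with f(3) show False ..
  qed
  \<comment> \<open>Every layer gets total weight 1 and the padding none, so the whole graph weighs
    \<open>k\<close> and an independent set weighs its density sum.\<close>
  define w where "w v = (if lev v < k then 1 / real (layer_size k (lev v)) else 0)" for v
  have w_sum: "(\<Sum>v\<in>I. w v) = (\<Sum>j<k. card (I \<inter> layer j) / layer_size k j)" if "I \<subseteq> U" for I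
  proof -
    have finI: "finite I"
      using that finite_U finite_subset by blast
    have "(\<Sum>v\<in>I. w v) = (\<Sum>v\<in>{v \<in> I. lev v < k}. 1 / real (layer_size k (lev v)))"
      using finI by (simp add: w_def sum.inter_filter)
    also have "\<dots> = (\<Sum>j<k. \<Sum>v | v \<in> {v \<in> I. lev v < k} \<and> lev v = j. 1 / real (layer_size k (lev v)))"
      using finI by (intro sum.group[symmetric]) auto
    also have "\<dots> = (\<Sum>j<k. card (I \<inter> layer j) / layer_size k j)"
    proof (intro sum.cong refl)
      fix j assume "j \<in> {..<k}"
      then have "{v \<in> {v \<in> I. lev v < k}. lev v = j} = I \<inter> layer j"
        using that by (auto simp: layer_def)
      moreover have "(\<Sum>v\<in>I \<inter> layer j. 1 / real (layer_size k (lev v))) = card (I \<inter> layer j) / layer_size k j"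
        by (simp add: layer_def)
      ultimately show "(\<Sum>v | v \<in> {v \<in> I. lev v < k} \<and> lev v = j. 1 / real (layer_size k (lev v))) =
          card (I \<inter> layer j) / layer_size k j"
        by simp
    qed
    finally show ?thesis .
  qed
  have "k / (ln k + 4) = (\<Sum>v\<in>pverts (graph f). w v) / (ln k + 4)"
  proof -
    have "U \<inter> layer j = layer j" for j
      by (auto simp: layer_def)
    then have "(\<Sum>v\<in>U. w v) = (\<Sum>j<k. 1)"
      using sizes by (simp add: w_sum layer_size_def)
    then show ?thesis
      by (simp add: graph_def)
  qed
  also have "\<dots> \<le> fractional_chromatic_number (graph f)"
  proof (rule fractional_chromatic_number_ge)
    show "pair_graph (graph f)"
      by (rule pair_graph_graph[OF f(1)])
    show "0 < ln (real k) + 4"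
      using \<open>3 \<le> k\<close> by (intro add_nonneg_pos ln_ge_zero) auto
    show "0 \<le> w v" for v
      by (simp add: w_def)
    show "(\<Sum>v\<in>I. w v) \<le> ln (real k) + 4" if I: "I \<in> independent_sets (graph f)" for I
    proof -
      have "I \<subseteq> U"
        using I by (simp add: independent_sets_def graph_def)
      then show ?thesis
        using independent_set_density_sum_le[OF f(1) _ sizes few I] \<open>3 \<le> k\<close> by (simp add: w_sum)
    qed
  qed
  finally show ?thesis
    using f that by (auto simp: A_def)
qed

end

section \<open>Padding to \<open>n\<close> vertices and the choice of \<open>k\<close>\<close>

lemma layered_graph_exists:
  assumes "3 \<le> k" and n: "k * layer_size k 0 \<le> n"
  shows "\<exists>G :: nat pair_pre_digraph. pair_graph G \<and> card (pverts G) = n \<and>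
    k / (ln k + 4) \<le> fractional_chromatic_number G \<and> \<not> has_regular_subgraph 4 G"
proof -
  define L where "L = layer_size k 0"
  have "L > 0"
    by (simp add: L_def layer_size_pos)
  \<comment> \<open>The numbers are cut into blocks of length \<open>L\<close>. For
    \<open>j < k\<close>, layer \<open>j\<close> consists of the first \<open>layer_size k j\<close>
    elements of block \<open>j\<close>; all other numbers get a level of at least \<open>k\<close>
    and serve as padding.\<close>
  define lev where "lev v = (if v mod L < layer_size k (v div L) then v div L else k)" for v
  interpret layered "{..<n}" lev k
    by unfold_locales simp
  have "card (layer j) = layer_size k j" if "j < k" for j
  proof -
    have le: "layer_size k j \<le> L"
      using layer_size_antimono[of 0 j k] by (simp add: L_def)
    have "layer j = (\<lambda>x. j * L + x) ` {..<layer_size k j}"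
    proof (intro equalityI subsetI)
      fix v assume "v \<in> layer j"
      then have "v div L = j" "v mod L < layer_size k j"
        using that by (auto simp: layer_def lev_def split: if_splits)
      then show "v \<in> (\<lambda>x. j * L + x) ` {..<layer_size k j}"
        by (metis div_mult_mod_eq image_eqI lessThan_iff)
    next
      fix v assume "v \<in> (\<lambda>x. j * L + x) ` {..<layer_size k j}"
      then obtain x where x: "v = j * L + x" "x < layer_size k j"
        by auto
      with le have "x < L" by simp
      have "v < Suc j * L"
        using x \<open>x < L\<close> by simp
      also have "\<dots> \<le> k * L"
        using that by (intro mult_le_mono1) simp
      also have "\<dots> \<le> n"
        using n by (simp add: L_def)
      finally have "v < n" .
      moreover have "v div L = j" "v mod L = x"
        using x \<open>x < L\<close> by auto
      ultimately show "v \<in> layer j"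
        using x by (simp add: layer_def lev_def)
    qed
    then show ?thesis
      by (simp add: card_image)
  qed
  from exists_choices[OF this \<open>3 \<le> k\<close>] obtain f where "f \<in> choices"
    "\<not> has_regular_subgraph 4 (graph f)" "k / (ln k + 4) \<le> fractional_chromatic_number (graph f)"
    by blast
  then show ?thesis
    using pair_graph_graph by (intro exI[of _ "graph f"]) (auto simp: graph_def)
qed

text \<open>The factor \<open>k \<le> 2 ^ k\<close> is absorbed by the unit subtracted in the
  exponent. As 16 exceeds 10, \<open>16 ^ k\<close> outgrows \<open>k * (100 * 10 ^ k)\<close>; the
  induction starts at \<open>k = 16\<close>.\<close>

lemma layer_size_total_le:
  assumes "16 \<le> k"
  shows "k * layer_size k 0 \<le> 2 ^ (16 ^ k)"
proof -
  have "k * layer_size k 0 \<le> 2 ^ k * 2 ^ (k * (100 * 10 ^ k - 1))"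
    unfolding layer_size_def by (intro mult_mono power_increasing) (auto simp: less_imp_le)
  also have "\<dots> = 2 ^ (k + k * (100 * 10 ^ k - 1))"
    by (simp add: power_add)
  also have "k + k * (100 * 10 ^ k - 1) = k * (100 * 10 ^ k)"
    by (simp add: algebra_simps)
  also have "(2::nat) ^ (k * (100 * 10 ^ k)) \<le> 2 ^ (16 ^ k)"
  proof (rule power_increasing)
    show "k * (100 * 10 ^ k) \<le> 16 ^ k"
      using assms
    proof (induction k rule: dec_induct)
      case (step k)
      have "Suc k * (100 * 10 ^ Suc k) = (10 * Suc k) * (100 * 10 ^ k)"
        by (simp add: algebra_simps)
      also have "\<dots> \<le> (16 * k) * (100 * 10 ^ k)"
        using step.hyps by (intro mult_le_mono1) simp
      also have "\<dots> \<le> 16 ^ Suc k"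
        using step.IH by simp
      finally show ?case .
    qed simp
  qed simp
  finally show ?thesis .
qed

theorem theorem1p2:
  shows "\<exists>c :: real. c > 0 \<and>
    (\<forall>\<^sub>F n :: nat in sequentially.
      \<exists>G :: nat pair_pre_digraph.
        pair_graph G \<and> card (pverts G) = n \<and>
        fractional_chromatic_number G \<ge> c * (ln (ln (real n)) / ln (ln (ln (real n)))) \<and>
        \<not> has_regular_subgraph 4 G)"
proof (intro exI[of _ "1 / 10"] conjI)
  have lim: "filterlim (\<lambda>n. ln (ln (real n))) at_top sequentially"
    by (intro filterlim_compose[OF ln_at_top] filterlim_real_sequentially)
  have "\<forall>\<^sub>F n in sequentially. 100 \<le> ln (ln (real n))"
    using lim by (simp add: filterlim_at_top)
  moreover have "\<forall>\<^sub>F n in sequentially. 4 \<le> ln (ln (ln (real n)))"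
    using filterlim_compose[OF ln_at_top lim] by (simp add: filterlim_at_top)
  moreover have "\<forall>\<^sub>F n in sequentially. 1 < ln (real n)"
    using filterlim_compose[OF ln_at_top filterlim_real_sequentially] by (simp add: filterlim_at_top_dense)
  ultimately show "\<forall>\<^sub>F n :: nat in sequentially. \<exists>G :: nat pair_pre_digraph.
        pair_graph G \<and> card (pverts G) = n \<and>
        fractional_chromatic_number G \<ge> 1 / 10 * (ln (ln (real n)) / ln (ln (ln (real n)))) \<and>
        \<not> has_regular_subgraph 4 G"
  proof eventually_elim
    case (elim n)
    define x where "x = ln (ln (real n))"
    \<comment> \<open>This \<open>k\<close> is small enough for the layers to fit into
      \<open>n\<close> vertices:
      \<open>16 ^ k \<le> exp (4 * (x / 5 + 1)) \<le> exp x = ln n\<close>, the middle step because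
      \<open>x \<ge> 20\<close>.\<close>
    define k where "k = nat \<lceil>x / 5\<rceil>"
    have k: "x / 5 \<le> k" "k \<le> x / 5 + 1"
      using elim(1) unfolding k_def x_def by linarith+
    have "20 \<le> k"
      using k(1) elim(1) by (simp add: x_def)
    have "2 ^ (16 ^ k) \<le> real n"
    proof -
      have "ln (16::real) = real 4 * ln 2"
        by (subst ln_realpow[symmetric]) auto
      then have ln16: "ln (16::real) \<le> 4"
        using ln_2_less_1 by simp
      have "(16::real) ^ k * ln 2 \<le> 16 ^ k"
        using ln_2_less_1 by simp
      also have "\<dots> = exp (k * ln 16)"
        by (simp add: exp_of_nat_mult)
      also have "\<dots> \<le> exp ((x / 5 + 1) * 4)"
        unfolding exp_le_cancel_iff using k ln16 by (intro mult_mono) auto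
      also have "\<dots> \<le> exp x"
        using elim(1) by (simp add: x_def)
      also have "\<dots> = ln (real n)"
        using elim(3) by (simp add: x_def)
      finally have "ln (2 ^ (16 ^ k)) \<le> ln (real n)"
        by (simp add: ln_realpow)
      moreover have "real n > 0"
        using elim(3) by (cases "n = 0") auto
      ultimately show ?thesis
        by (subst (asm) ln_le_cancel_iff) auto
    qed
    then have "2 ^ (16 ^ k) \<le> n"
      by (metis of_nat_le_iff of_nat_numeral of_nat_power)
    with layer_size_total_le[of k] \<open>20 \<le> k\<close> have "k * layer_size k 0 \<le> n"
      by linarith
    from layered_graph_exists[OF _ this] \<open>20 \<le> k\<close> obtain G :: "nat pair_pre_digraph" where
      G: "pair_graph G" "card (pverts G) = n" "k / (ln k + 4) \<le> fractional_chromatic_number G"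
        "\<not> has_regular_subgraph 4 G"
      by auto
    \<comment> \<open>The constant splits into \<open>1 / 5\<close> from
      \<open>k \<ge> x / 5\<close> and \<open>1 / 2\<close> from
      \<open>ln k + 4 \<le> 2 * ln x\<close>.\<close>
    have "1 / 10 * (x / ln x) = (x / 5) / (ln x + ln x)"
      by simp
    also have "\<dots> \<le> k / (ln k + 4)"
    proof (rule frac_le)
      have "ln (real k) \<le> ln x"
        using k(2) elim(1) \<open>20 \<le> k\<close> by (subst ln_le_cancel_iff) (auto simp: x_def)
      then show "ln (real k) + 4 \<le> ln x + ln x"
        using elim(2) by (simp add: x_def)
      show "0 < ln (real k) + 4"
        using \<open>20 \<le> k\<close> by (intro add_nonneg_pos ln_ge_zero) auto
    qed (use k elim(1) in \<open>auto simp: x_def\<close>)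
    finally show ?case
      using G by (intro exI[of _ G]) (auto simp: x_def)
  qed
qed simp

end
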